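(* Let $G$ be a countable, discrete group with a generating probability measure $\mu$ with finite entropy $H(\mu)<\infty$. Let $\Gamma$ be a finite index subgroup of $G$, with hitting measure $\theta$. Then $$h(\Gamma,\theta)=[G:\Gamma]\cdot h(G,\mu),$$ where $h(\cdot,\cdot)$ denotes the random walk entropy.
   Context: Generating: a probability measure $\mu$ on the countable group $G$ is generating if the semigroup generated by its support $\{g\in G : \mu(g)>0\}$ is all of $G$. The entropy of a probability measure $\mu$ on a countable set is $H(\mu)=-\sum_{g}\mu(g)\log\mu(g)$, with $0\log 0=0$. Random walk entropy (Avez entropy, asymptotic entropy): for a probability measure $\mu$ on a countable group $G$, $h(G,\mu)=\lim_{n\to\infty}\frac1n H(\mu^n)$, where $\mu^n$ is the $n$-fold convolution of $\mu$ with itself, convolution being $[\mu_1*\mu_2](g)=\sum_{g'\in G}\mu_1(g')\mu_2(g'^{-1}g)$. Similarly $h(\Gamma,\theta)=\lim_{n\to\infty}\frac1n H(\theta^n)$. Hitting measure: let $X_1,X_2,\ldots$ be i.i.d. $G$-valued random variables with law $\mu$, and $Z_n=X_1X_2\cdots X_n$ (the $\mu$-random walk on $G$ started at the identity). A finite index subgroup $\Gamma$ is $\mu$-recurrent, i.e. almost surely there is $n\ge 1$ with $Z_n\in\Gamma$. The return time is $\tau=\min\{n\ge 1 : Z_n\in\Gamma\}$, which is almost surely finite, and the hitting measure $\theta$ is the probability measure on $\Gamma$ given by $\theta(\gamma)=\mathbb{P}[Z_\tau=\gamma]$. *)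

theory Defs
  imports "HOL-Algebra.Coset" "HOL-Probability.Probability"
begin

inductive_set semigroup_generated :: "('a, 'b) monoid_scheme \<Rightarrow> 'a set \<Rightarrow> 'a set"
  for G and S where
    incl: "s \<in> S \<Longrightarrow> s \<in> semigroup_generated G S"
  | mult: "x \<in> semigroup_generated G S \<Longrightarrow> y \<in> semigroup_generated G S
             \<Longrightarrow> x \<otimes>\<^bsub>G\<^esub> y \<in> semigroup_generated G S"

(* Probability measures on G enter the next three notions through their mass functions on
   carrier G. Entropy takes values in [0,\<infinity>], so that finiteness is a meaningful condition;
   ln 0 = 0 gives the convention 0 log 0 = 0. *)

definition entropy_on :: "('a, 'b) monoid_scheme \<Rightarrow> ('a \<Rightarrow> real) \<Rightarrow> ennreal" where
  "entropy_on G f = (\<Sum>\<^sub>\<infinity>g\<in>carrier G. ennreal (- (f g * ln (f g))))"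

definition convolution_on ::
    "('a, 'b) monoid_scheme \<Rightarrow> ('a \<Rightarrow> real) \<Rightarrow> ('a \<Rightarrow> real) \<Rightarrow> 'a \<Rightarrow> real" where
  "convolution_on G f\<^sub>1 f\<^sub>2 g = (\<Sum>\<^sub>\<infinity>g'\<in>carrier G. f\<^sub>1 g' * f\<^sub>2 (inv\<^bsub>G\<^esub> g' \<otimes>\<^bsub>G\<^esub> g))"

primrec convolution_power ::
    "('a, 'b) monoid_scheme \<Rightarrow> ('a \<Rightarrow> real) \<Rightarrow> nat \<Rightarrow> 'a \<Rightarrow> real" where
  "convolution_power G f 0 = indicator {\<one>\<^bsub>G\<^esub>}"
| "convolution_power G f (Suc n) = convolution_on G (convolution_power G f n) f"

definition random_walk_entropy :: "('a, 'b) monoid_scheme \<Rightarrow> ('a \<Rightarrow> real) \<Rightarrow> ennreal" where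
  "random_walk_entropy G f = lim (\<lambda>n. entropy_on G (convolution_power G f n) / of_nat n)"

(* Canonical space of increment sequences. Restricting to the (countable) carrier makes every
   event about finitely many increments measurable even if the type 'a is uncountable. *)
definition increment_space ::
    "('a, 'b) monoid_scheme \<Rightarrow> 'a pmf \<Rightarrow> (nat \<Rightarrow> 'a) measure" where
  "increment_space G \<mu> =
     (\<Pi>\<^sub>M i\<in>(UNIV :: nat set). restrict_space (measure_pmf \<mu>) (carrier G))"

(* The increment X_(n+1) is the coordinate x n, as coordinates are numbered from 0. *)
primrec random_walk :: "('a, 'b) monoid_scheme \<Rightarrow> (nat \<Rightarrow> 'a) \<Rightarrow> nat \<Rightarrow> 'a" where
  "random_walk G x 0 = \<one>\<^bsub>G\<^esub>"
| "random_walk G x (Suc n) = random_walk G x n \<otimes>\<^bsub>G\<^esub> x n"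

definition return_time :: "('a, 'b) monoid_scheme \<Rightarrow> 'a set \<Rightarrow> (nat \<Rightarrow> 'a) \<Rightarrow> nat" where
  "return_time G \<Gamma> x = (LEAST n. n \<ge> 1 \<and> random_walk G x n \<in> \<Gamma>)"

(* The first conjunct excludes paths that never return, where LEAST is unspecified. *)
definition hitting_measure ::
    "('a, 'b) monoid_scheme \<Rightarrow> 'a pmf \<Rightarrow> 'a set \<Rightarrow> 'a \<Rightarrow> real" where
  "hitting_measure G \<mu> \<Gamma> \<gamma> =
     measure (increment_space G \<mu>)
       {x \<in> space (increment_space G \<mu>).
          (\<exists>n\<ge>1. random_walk G x n \<in> \<Gamma>) \<and> random_walk G x (return_time G \<Gamma> x) = \<gamma>}"

end

(* Let tau_k be the k-th return time to Gamma and d the index. Since a letter permutes the cosets, the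
   coset chain has uniform stationary law, so by Kac's formula tau_k has mean d k; it also has variance
   O(k). The position at time tau_k has law theta^k, the position at time d k has law mu^(d k), and they
   differ by a factor spelled by the letters read between the two times. Encoding this factor costs,
   by Wald's identity, O(E|tau_k - d k|) = O(sqrt k) in entropy, so H(theta^k) and H(mu^(d k)) have the
   same linear growth rate in k. *)

theory Submission
  imports Defs "HOL-Real_Asymp.Real_Asymp"
begin

text \<open>The support of \<open>\<mu>\<close> may be infinite, so a factor spelled by m letters
  cannot be charged by counting words of length m. It is charged its information under a fixed
  reference law on words, a product law with a geometric length; finite entropy of
  \<open>\<mu>\<close> makes the mean charge per letter finite. The factor is not independent of the
  position it is multiplied to. This does no harm: by Gibbs' inequality the mean of minus the
  logarithm of any reference law bounds the entropy cost, whatever the dependence, so only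
  expectations enter and Wald's identity evaluates them. The mean deviation of tau_k is sublinear
  because the first return has a finite second moment. That comes from finiteness of the coset
  space: after any number of steps without return, the mean remaining time is bounded by one
  constant. All means and entropies live in [0,\<infinity>], so identities that are usually stated
  with differences, such as additivity of the variance, are arranged as equalities of sums.\<close>

section \<open>Entropy as mean information, Gibbs' inequality and the coding of words\<close>

definition neg_ln :: "real \<Rightarrow> ennreal" where
  "neg_ln x = (if x \<le> 0 then \<infinity> else ennreal (- ln x))"

lemma neg_ln_antimono: "x \<le> y \<Longrightarrow> neg_ln y \<le> neg_ln x"
  by (auto simp: neg_ln_def intro!: ennreal_leI)

lemma neg_ln_mult:
  assumes "0 \<le> x" "x \<le> 1" "0 \<le> y" "y \<le> 1"
  shows "neg_ln (x * y) = neg_ln x + neg_ln y"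
proof (cases "x = 0 \<or> y = 0")
  case False
  then have "0 < x" "0 < y" using assms by auto
  then show ?thesis using assms
    by (auto simp: neg_ln_def ln_mult ennreal_plus[symmetric] simp del: ennreal_plus
        simp: mult_le_0_iff ln_le_zero_iff add.commute)
qed (auto simp: neg_ln_def)

definition entropy_pmf :: "'a pmf \<Rightarrow> ennreal" where
  "entropy_pmf p = (\<integral>\<^sup>+x. neg_ln (pmf p x) \<partial>measure_pmf p)"

lemma nn_integral_pmf_ratio_le_1: "(\<integral>\<^sup>+x. ennreal (pmf r x / pmf p x) \<partial>measure_pmf p) \<le> 1"
proof -
  have "(\<integral>\<^sup>+x. ennreal (pmf r x / pmf p x) \<partial>measure_pmf p)
      = (\<integral>\<^sup>+x. ennreal (pmf p x) * ennreal (pmf r x / pmf p x) \<partial>count_space UNIV)"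
    by (rule nn_integral_measure_pmf)
  also have "\<dots> \<le> (\<integral>\<^sup>+x. ennreal (pmf r x) \<partial>count_space UNIV)"
    by (intro nn_integral_mono) (auto simp: ennreal_mult'[symmetric])
  also have "\<dots> = 1" by (simp add: nn_integral_pmf)
  finally show ?thesis .
qed

text \<open>This is \<open>ln t \<le> t - 1\<close> at the ratio t of the two masses, averaged over
  \<open>p\<close>. Adding 1 on both sides avoids differences in [0,\<infinity>]. Where
  \<open>r\<close> misses an atom of \<open>p\<close> the right-hand side is infinite, so no
  condition on supports or finiteness arises.\<close>

lemma gibbs_inequality: "entropy_pmf p \<le> (\<integral>\<^sup>+x. neg_ln (pmf r x) \<partial>measure_pmf p)"
proof -
  have "entropy_pmf p + 1 = (\<integral>\<^sup>+x. neg_ln (pmf p x) + 1 \<partial>measure_pmf p)"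
    by (simp add: entropy_pmf_def nn_integral_add)
  also have "\<dots> \<le> (\<integral>\<^sup>+x. neg_ln (pmf r x) + ennreal (pmf r x / pmf p x) \<partial>measure_pmf p)"
  proof (intro nn_integral_mono_AE AE_pmfI)
    fix x assume x: "x \<in> set_pmf p"
    then have p: "0 < pmf p x" "pmf p x \<le> 1" by (auto simp: pmf_positive pmf_le_1)
    show "neg_ln (pmf p x) + 1 \<le> neg_ln (pmf r x) + ennreal (pmf r x / pmf p x)"
    proof (cases "pmf r x = 0")
      case False
      then have r: "0 < pmf r x" "pmf r x \<le> 1" by (auto simp: pmf_le_1 less_le)
      have "ln (pmf r x / pmf p x) \<le> pmf r x / pmf p x - 1"
        using r p by (intro ln_le_minus_one) auto
      then have "- ln (pmf p x) + 1 \<le> - ln (pmf r x) + pmf r x / pmf p x"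
        using r p by (simp add: ln_div)
      then have "ennreal (- ln (pmf p x) + 1) \<le> ennreal (- ln (pmf r x) + pmf r x / pmf p x)"
        by (rule ennreal_leI)
      moreover have "ennreal (- ln (pmf p x) + 1) = neg_ln (pmf p x) + 1"
        using p by (subst ennreal_plus) (auto simp: neg_ln_def)
      moreover have "ennreal (- ln (pmf r x) + pmf r x / pmf p x)
          = neg_ln (pmf r x) + ennreal (pmf r x / pmf p x)"
        using r p by (subst ennreal_plus) (auto simp: neg_ln_def)
      ultimately show ?thesis by simp
    qed (simp add: neg_ln_def)
  qed
  also have "\<dots> = (\<integral>\<^sup>+x. neg_ln (pmf r x) \<partial>measure_pmf p)
      + (\<integral>\<^sup>+x. ennreal (pmf r x / pmf p x) \<partial>measure_pmf p)"
    by (simp add: nn_integral_add)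
  also have "\<dots> \<le> (\<integral>\<^sup>+x. neg_ln (pmf r x) \<partial>measure_pmf p) + 1"
    by (intro add_left_mono nn_integral_pmf_ratio_le_1)
  finally have "1 + entropy_pmf p \<le> 1 + (\<integral>\<^sup>+x. neg_ln (pmf r x) \<partial>measure_pmf p)"
    by (simp only: add.commute)
  then show ?thesis
    by (rule ennreal_add_left_cancel_le[THEN iffD1, THEN disjE]) auto
qed

text \<open>A map merges atoms, so the information of each single outcome can only drop.\<close>

lemma entropy_map_pmf_le: "entropy_pmf (map_pmf f J) \<le> entropy_pmf J"
  unfolding entropy_pmf_def nn_integral_map_pmf
proof (intro nn_integral_mono neg_ln_antimono)
  fix x
  show "pmf J x \<le> pmf (map_pmf f J) (f x)"
    unfolding pmf_map by (subst pmf.rep_eq) (rule measure_pmf.finite_measure_mono, auto)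
qed

text \<open>Gibbs' inequality for \<open>J\<close> against the product of its first marginal with
  \<open>q\<close>. The two coordinates may be dependent and the law of the second need not be
  known: any convenient \<open>q\<close> serves as its code.\<close>

lemma entropy_map_coupling_le:
  "entropy_pmf (map_pmf f J)
     \<le> entropy_pmf (map_pmf fst J) + (\<integral>\<^sup>+x. neg_ln (pmf q (snd x)) \<partial>measure_pmf J)"
proof -
  have "entropy_pmf (map_pmf f J) \<le> (\<integral>\<^sup>+x. neg_ln (pmf (pair_pmf (map_pmf fst J) q) x) \<partial>measure_pmf J)"
    by (rule order_trans[OF entropy_map_pmf_le gibbs_inequality])
  also have "\<dots> = (\<integral>\<^sup>+x. neg_ln (pmf (map_pmf fst J) (fst x)) + neg_ln (pmf q (snd x)) \<partial>measure_pmf J)"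
  proof (intro nn_integral_cong)
    fix x :: "'b \<times> 'c"
    show "neg_ln (pmf (pair_pmf (map_pmf fst J) q) x)
        = neg_ln (pmf (map_pmf fst J) (fst x)) + neg_ln (pmf q (snd x))"
      by (cases x) (simp add: pmf_pair neg_ln_mult pmf_le_1)
  qed
  also have "\<dots> = entropy_pmf (map_pmf fst J) + (\<integral>\<^sup>+x. neg_ln (pmf q (snd x)) \<partial>measure_pmf J)"
    by (simp add: nn_integral_add entropy_pmf_def)
  finally show ?thesis .
qed

lemma entropy_pair_pmf: "entropy_pmf (pair_pmf p q) = entropy_pmf p + entropy_pmf q"
proof -
  have "entropy_pmf (pair_pmf p q) = (\<integral>\<^sup>+x. \<integral>\<^sup>+y. neg_ln (pmf p x) + neg_ln (pmf q y) \<partial>q \<partial>p)"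
    unfolding entropy_pmf_def nn_integral_pair_pmf' by (simp add: pmf_pair neg_ln_mult pmf_le_1)
  then show ?thesis by (simp add: nn_integral_add entropy_pmf_def)
qed

lemma entropy_return_pmf: "entropy_pmf (return_pmf x) = 0"
  by (simp add: entropy_pmf_def neg_ln_def)

text \<open>The Boolean flag is meant to record which of the two times compared comes first.\<close>

definition word_code :: "'a pmf \<Rightarrow> (bool \<times> 'a list) pmf" where
  "word_code p = pair_pmf (pmf_of_set UNIV) (bind_pmf (geometric_pmf (1/2)) (\<lambda>n. replicate_pmf n p))"

lemma pmf_replicate_pmf: "pmf (replicate_pmf (length u) p) u = (\<Prod>x\<leftarrow>u. pmf p x)"
proof (induction u)
  case (Cons a u)
  have eq: "replicate_pmf (length (a # u)) p
      = map_pmf (\<lambda>(x, xs). x # xs) (pair_pmf p (replicate_pmf (length u) p))"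
    by (simp add: pair_pmf_def map_bind_pmf map_pmf_def bind_assoc_pmf bind_return_pmf)
  have "pmf (replicate_pmf (length (a # u)) p) ((\<lambda>(x, xs). x # xs) (a, u))
      = pmf (pair_pmf p (replicate_pmf (length u) p)) (a, u)"
    unfolding eq by (rule pmf_map_inj') (auto simp: inj_on_def)
  then show ?case using Cons.IH by (simp add: pmf_pair)
qed simp

lemma neg_ln_prod_list: "neg_ln (\<Prod>x\<leftarrow>u. pmf p x) = (\<Sum>x\<leftarrow>u. neg_ln (pmf p x))"
proof (induction u)
  case (Cons a u)
  have "(\<Prod>x\<leftarrow>u. pmf p x) \<le> 1" "0 \<le> (\<Prod>x\<leftarrow>u. pmf p x)"
    unfolding pmf_replicate_pmf[symmetric] by (simp_all add: pmf_le_1)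
  with Cons show ?case by (simp add: neg_ln_mult pmf_le_1)
qed (simp add: neg_ln_def)

text \<open>A geometric length n has mass \<open>(1/2) ^ Suc n\<close> and the flag has mass 1/2,
  which accounts for \<open>length u + 2\<close> factors 1/2. Keeping only the summand with the
  correct length bounds the mixture from below.\<close>

lemma neg_ln_word_code_le:
  "neg_ln (pmf (word_code p) (b, u))
     \<le> ennreal (ln 2 * (real (length u) + 2)) + (\<Sum>x\<leftarrow>u. neg_ln (pmf p x))"
proof -
  let ?W = "bind_pmf (geometric_pmf (1/2)) (\<lambda>n. replicate_pmf n p)"
  let ?P = "\<Prod>x\<leftarrow>u. pmf p x"
  have P: "0 \<le> ?P" "?P \<le> 1"
    unfolding pmf_replicate_pmf[symmetric] by (simp_all add: pmf_le_1)
  have "ennreal ((1/2) ^ Suc (length u) * ?P) =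
      (\<integral>\<^sup>+n. ennreal (pmf (replicate_pmf n p) u) * indicator {length u} n \<partial>geometric_pmf (1/2))"
    by (subst nn_integral_indicator_singleton)
       (auto simp: emeasure_pmf_single pmf_replicate_pmf ennreal_mult'[symmetric] mult.commute P
          intro!: arg_cong[where f = ennreal])
  also have "\<dots> \<le> ennreal (pmf ?W u)"
    unfolding ennreal_pmf_bind by (intro nn_integral_mono) (auto simp: indicator_def)
  finally have "(1/2) ^ Suc (length u) * ?P \<le> pmf ?W u" by simp
  then have "(1/2) ^ (length u + 2) * ?P \<le> pmf (word_code p) (b, u)"
    by (simp add: word_code_def pmf_pair mult.commute)
  then have "neg_ln (pmf (word_code p) (b, u)) \<le> neg_ln ((1/2) ^ (length u + 2) * ?P)"
    by (rule neg_ln_antimono)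
  also have "\<dots> = neg_ln ((1/2) ^ (length u + 2)) + neg_ln ?P"
    by (intro neg_ln_mult power_le_one zero_le_power P) auto
  also have "neg_ln ((1/2) ^ (length u + 2)) = ennreal (ln 2 * (real (length u) + 2))"
  proof -
    have "0 < (1 / 2 :: real) ^ (length u + 2)" by simp
    moreover have "- ln ((1 / 2 :: real) ^ (length u + 2)) = ln 2 * (real (length u) + 2)"
      by (simp only: ln_realpow ln_div) (simp add: algebra_simps ln_div)
    ultimately show ?thesis by (simp only: neg_ln_def not_le[symmetric] if_False)
  qed
  finally show ?thesis by (simp add: neg_ln_prod_list)
qed

section \<open>Subadditive sequences and comparison of growth rates\<close>

lemma subadditive_mult_le:
  fixes a :: "nat \<Rightarrow> real"
  assumes sub: "\<And>m n. a (m + n) \<le> a m + a n"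
  shows "a (q * m + r) \<le> real q * a m + a r"
proof (induction q)
  case (Suc q)
  have "a (Suc q * m + r) = a (m + (q * m + r))" by (simp add: algebra_simps)
  also have "\<dots> \<le> a m + (real q * a m + a r)" using sub[of m "q * m + r"] Suc by linarith
  finally show ?case by (simp add: algebra_simps)
qed simp

text \<open>Fekete's lemma; the limit is the infimum of the quotients. Division with remainder by an
  \<open>m\<close> that nearly attains the infimum leaves a remainder term bounded by
  \<open>M\<close>, which is negligible after division by \<open>n\<close>.\<close>

lemma fekete:
  fixes a :: "nat \<Rightarrow> real"
  assumes sub: "\<And>m n. a (m + n) \<le> a m + a n" and nonneg: "\<And>n. 0 \<le> a n"
  shows "\<exists>L\<ge>0. (\<lambda>n. a n / real n) \<longlonglongrightarrow> L"
proof -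
  define L where "L = (INF n\<in>{1..}. a n / real n)"
  have bdd: "bdd_below ((\<lambda>n. a n / real n) ` {1..})"
    by (rule bdd_belowI[of _ 0]) (auto simp: nonneg)
  have L_le: "L \<le> a n / real n" if "1 \<le> n" for n
    unfolding L_def by (rule cINF_lower[OF bdd]) (use that in auto)
  have "L \<ge> 0" unfolding L_def by (rule cINF_greatest) (auto simp: nonneg)
  moreover have "(\<lambda>n. a n / real n) \<longlonglongrightarrow> L"
  proof (rule LIMSEQ_I)
    fix e :: real assume e: "0 < e"
    have "\<exists>m\<in>{1..}. a m / real m < L + e / 2"
      using e cINF_less_iff[of "{1..}" "\<lambda>n. a n / real n" "L + e / 2"] bdd
      unfolding L_def by auto
    then obtain m where m: "1 \<le> m" "a m / real m < L + e / 2" by auto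
    define M where "M = Max (a ` {..<m})"
    have M: "a r \<le> M" if "r < m" for r unfolding M_def using that by (intro Max_ge) auto
    have M0: "0 \<le> M" using M[of 0] nonneg[of 0] m by auto
    obtain N where N: "N > 0" "M / real N < e / 2"
    proof -
      obtain N :: nat where "2 * M / e < real N" using reals_Archimedean2 by blast
      then have "2 * M / e < real (Suc N)" by simp
      then have "M / real (Suc N) < e / 2" using e by (simp add: field_simps)
      then show ?thesis using that[of "Suc N"] by auto
    qed
    show "\<exists>no. \<forall>n\<ge>no. norm (a n / real n - L) < e"
    proof (intro exI allI impI)
      fix n assume n: "N \<le> n"
      then have n0: "0 < n" using N by simp
      have "a n = a (n div m * m + n mod m)" by simp
      also have "\<dots> \<le> real (n div m) * a m + M"
        using subadditive_mult_le[of a "n div m" m "n mod m", OF sub] M[of "n mod m"] m by simp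
      finally have "a n / real n \<le> real (n div m) * a m / real n + M / real n"
        using n0 by (simp add: field_simps)
      also have "real (n div m) * a m / real n \<le> a m / real m"
      proof -
        have "real (n div m * m) \<le> real n" by (rule of_nat_mono) (rule div_times_less_eq_dividend)
        then have "real (n div m) * real m * a m \<le> real n * a m"
          by (intro mult_right_mono nonneg) simp
        then show ?thesis using n0 m by (simp add: field_simps)
      qed
      also have "M / real n \<le> M / real N"
        using n N M0 by (intro divide_left_mono) auto
      finally have "a n / real n < L + e" using m(2) N(2) by linarith
      then show "norm (a n / real n - L) < e" using L_le[of n] n0 by simp
    qed
  qed
  ultimately show ?thesis by blast
qed

text \<open>A squeeze between \<open>a (d * k)\<close> plus and minus a sublinear error, along the
  subsequence of multiples of \<open>d\<close>. The upper bound makes \<open>E k\<close> finite, so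
  the argument can be carried out in the reals.\<close>

lemma comparison_limit:
  fixes a :: "nat \<Rightarrow> real" and E :: "nat \<Rightarrow> ennreal" and c :: "nat \<Rightarrow> real"
  assumes lim: "(\<lambda>n. a n / real n) \<longlonglongrightarrow> L" and L: "0 \<le> L"
    and nonneg: "\<And>n. 0 \<le> a n"
    and d: "0 < d"
    and c0: "\<And>k. 0 \<le> c k" and c: "(\<lambda>k. c k / real k) \<longlonglongrightarrow> 0"
    and upper: "\<And>k. E k \<le> ennreal (a (d * k)) + ennreal (c k)"
    and lower: "\<And>k. ennreal (a (d * k)) \<le> E k + ennreal (c k)"
  shows "(\<lambda>k. E k / of_nat k) \<longlonglongrightarrow> of_nat d * ennreal L"
proof -
  define r where "r k = enn2real (E k)" for k
  have r: "E k = ennreal (r k)" for k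
  proof -
    have "E k < \<infinity>" by (rule le_less_trans[OF upper]) simp
    then show ?thesis unfolding r_def by simp
  qed
  have r0: "0 \<le> r k" for k by (simp add: r_def)
  have up: "r k \<le> a (d * k) + c k" for k
    using upper[of k] r0[of k] nonneg[of "d * k"] c0[of k] unfolding r
    by (simp add: ennreal_plus[symmetric] del: ennreal_plus)
  have lo: "a (d * k) \<le> r k + c k" for k
    using lower[of k] r0[of k] nonneg[of "d * k"] c0[of k] unfolding r
    by (simp add: ennreal_plus[symmetric] del: ennreal_plus)
  have "filterlim (\<lambda>k. d * k) sequentially sequentially"
    by (rule mult_nat_left_at_top[OF d])
  from filterlim_compose[OF lim this]
  have "(\<lambda>k. real d * (a (d * k) / real (d * k))) \<longlonglongrightarrow> real d * L"
    by (intro tendsto_mult tendsto_const)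
  then have main: "(\<lambda>k. a (d * k) / real k) \<longlonglongrightarrow> real d * L"
    using d by simp
  have "(\<lambda>k. r k / real k) \<longlonglongrightarrow> real d * L"
  proof (rule real_tendsto_sandwich)
    show "(\<lambda>k. a (d * k) / real k - c k / real k) \<longlonglongrightarrow> real d * L"
      using tendsto_diff[OF main c] by simp
    show "(\<lambda>k. a (d * k) / real k + c k / real k) \<longlonglongrightarrow> real d * L"
      using tendsto_add[OF main c] by simp
    show "\<forall>\<^sub>F k in sequentially. a (d * k) / real k - c k / real k \<le> r k / real k"
    proof (intro always_eventually allI)
      fix k
      show "a (d * k) / real k - c k / real k \<le> r k / real k"
        unfolding diff_divide_distrib[symmetric]
        by (intro divide_right_mono) (use lo[of k] in auto)
    qed
    show "\<forall>\<^sub>F k in sequentially. r k / real k \<le> a (d * k) / real k + c k / real k"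
    proof (intro always_eventually allI)
      fix k
      show "r k / real k \<le> a (d * k) / real k + c k / real k"
        unfolding add_divide_distrib[symmetric]
        by (intro divide_right_mono) (use up[of k] in auto)
    qed
  qed
  then have "(\<lambda>k. ennreal (r k / real k)) \<longlonglongrightarrow> ennreal (real d * L)"
    by (rule tendsto_ennrealI)
  moreover have "\<forall>\<^sub>F k in sequentially. ennreal (r k / real k) = E k / of_nat k"
    using eventually_gt_at_top[of 0]
  proof eventually_elim
    case (elim k)
    have "E k / of_nat k = ennreal (r k) / ennreal (real k)" by (simp add: r ennreal_of_nat_eq_real_of_nat)
    then show ?case using r0 elim by (simp add: divide_ennreal)
  qed
  ultimately have "(\<lambda>k. E k / of_nat k) \<longlonglongrightarrow> ennreal (real d * L)"
    by (rule Lim_transform_eventually)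
  also have "ennreal (real d * L) = of_nat d * ennreal L"
    by (simp add: ennreal_mult' ennreal_of_nat_eq_real_of_nat)
  finally show ?thesis .
qed

section \<open>Return times of a finite walk driven by permutations: Kac's formula and the second
  moment\<close>

lemma pmf_map_option_None: "pmf (map_pmf (map_option f) p) None = pmf p None"
proof -
  have "map_option f -` {None} = {None}" by auto
  then show ?thesis by (simp add: pmf_map measure_pmf_single)
qed

lemma suminf_less_length: "(\<Sum>n. if n < L then f n else 0) = (\<Sum>n<L. f n)"
  for f :: "nat \<Rightarrow> ennreal"
  by (subst suminf_finite[of "{..<L}"]) auto

text \<open>The sum is a triangular number. In this form a second moment is bounded by a double sum
  of tail probabilities.\<close>

lemma square_le_sum: "L\<^sup>2 \<le> 2 * (\<Sum>n<L. L - n)" for L :: nat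
proof -
  have "2 * (\<Sum>n<L. L - n) = L * (L + 1)"
  proof (induction L)
    case (Suc L)
    have "(\<Sum>n<Suc L. Suc L - n) = (\<Sum>n<L. L - n) + Suc L"
      by (subst sum.lessThan_Suc_shift) simp
    then show ?case using Suc by simp
  qed simp
  then show ?thesis by (simp add: power2_eq_square)
qed

text \<open>An abstraction of the coset chain: the states will be the right cosets of
  \<open>\<Gamma>\<close>, a letter acts by right multiplication, and \<open>orig\<close> is
  \<open>\<Gamma>\<close> itself.\<close>

locale bijective_walk =
  fixes \<mu> :: "'a pmf" and S :: "'s set" and step :: "'s \<Rightarrow> 'a \<Rightarrow> 's" and orig :: 's
  assumes finite_S: "finite S" and orig_S: "orig \<in> S"
    and bij: "a \<in> set_pmf \<mu> \<Longrightarrow> bij_betw (\<lambda>c. step c a) S S"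
    and reach: "c \<in> S \<Longrightarrow> \<exists>u\<in>lists (set_pmf \<mu>). foldl step orig u = c"
begin

lemma step_S: "c \<in> S \<Longrightarrow> a \<in> set_pmf \<mu> \<Longrightarrow> step c a \<in> S"
  using bij bij_betw_apply by fast

text \<open>The probability that the walk started at \<open>c\<close> misses the origin at all times
  from 1 to n. The start does not count, so at \<open>c = orig\<close> this is the tail of the
  return time. The first-step recursion makes a path space unnecessary.\<close>

primrec avoid :: "nat \<Rightarrow> 's \<Rightarrow> ennreal" where
  "avoid 0 c = 1"
| "avoid (Suc n) c = (\<integral>\<^sup>+a. (if step c a = orig then 0 else avoid n (step c a)) \<partial>\<mu>)"

lemma avoid_Suc_le: "avoid (Suc n) c \<le> avoid n c"
proof (induction n arbitrary: c)
  case 0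
  have "avoid (Suc 0) c \<le> (\<integral>\<^sup>+a. 1 \<partial>\<mu>)"
    unfolding avoid.simps by (intro nn_integral_mono) auto
  then show ?case by simp
next
  case (Suc n)
  have "avoid (Suc (Suc n)) c = (\<integral>\<^sup>+a. (if step c a = orig then 0 else avoid (Suc n) (step c a)) \<partial>\<mu>)"
    by (rule avoid.simps(2))
  also have "\<dots> \<le> (\<integral>\<^sup>+a. (if step c a = orig then 0 else avoid n (step c a)) \<partial>\<mu>)"
    by (intro nn_integral_mono) (use Suc.IH in \<open>auto simp del: avoid.simps\<close>)
  finally show ?case by simp
qed

lemma avoid_le_1: "avoid n c \<le> 1"
  by (induction n) (auto intro: order_trans[OF avoid_Suc_le] simp del: avoid.simps(2))

text \<open>The uniform law on \<open>S\<close> is stationary because every letter permutes \<open>S\<close>.\<close>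

lemma sum_avoid_Suc: "(\<Sum>c\<in>S. avoid (Suc n) c) + avoid n orig = (\<Sum>c\<in>S. avoid n c)"
proof -
  let ?f = "\<lambda>c. if c = orig then 0 else avoid n c"
  have "(\<Sum>c\<in>S. avoid (Suc n) c) = (\<integral>\<^sup>+a. (\<Sum>c\<in>S. ?f (step c a)) \<partial>\<mu>)"
    by (simp add: nn_integral_sum)
  also have "\<dots> = (\<integral>\<^sup>+a. (\<Sum>c\<in>S. ?f c) \<partial>\<mu>)"
    by (intro nn_integral_cong_AE AE_pmfI sum.reindex_bij_betw bij)
  also have "\<dots> = (\<Sum>c\<in>S. ?f c)" by simp
  finally have "(\<Sum>c\<in>S. avoid (Suc n) c) = (\<Sum>c\<in>S. ?f c)" .
  moreover have "(\<Sum>c\<in>S. ?f c) = (\<Sum>c\<in>S - {orig}. avoid n c)"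
    by (subst sum.remove[OF finite_S orig_S]) (auto intro!: sum.cong)
  ultimately show ?thesis
    using sum.remove[OF finite_S orig_S, of "avoid n"] by (simp add: add.commute)
qed

text \<open>The stationarity identity telescopes. The second sum is \<open>card S\<close> times the
  probability that a uniformly started walk misses the origin up to time \<open>N\<close>; Kac's
  formula amounts to its vanishing in the limit.\<close>

lemma kac_partial: "(\<Sum>n<N. avoid n orig) + (\<Sum>c\<in>S. avoid N c) = of_nat (card S)"
proof (induction N)
  case (Suc N)
  have "(\<Sum>n<Suc N. avoid n orig) + (\<Sum>c\<in>S. avoid (Suc N) c)
      = (\<Sum>n<N. avoid n orig) + ((\<Sum>c\<in>S. avoid (Suc N) c) + avoid N orig)"
    by (simp add: algebra_simps del: avoid.simps)
  then show ?case unfolding sum_avoid_Suc Suc .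
qed simp

definition mean_hit :: "'s \<Rightarrow> ennreal" where "mean_hit c = (\<Sum>n. avoid n c)"

text \<open>The half of Kac's formula that is available before the remainder is known to vanish. Its
  finiteness is propagated to all states, and this in turn makes the remainder vanish.\<close>

lemma mean_hit_orig_le: "mean_hit orig \<le> of_nat (card S)"
  unfolding mean_hit_def
proof (rule suminf_le_const)
  fix N
  show "(\<Sum>n<N. avoid n orig) \<le> of_nat (card S)"
    unfolding kac_partial[of N, symmetric] by simp
qed simp

text \<open>A state reached from \<open>c\<close> by an admissible letter without passing through the origin is hit with
  positive probability, so its mean hitting time is controlled by that of \<open>c\<close>.\<close>

lemma mean_hit_step:
  assumes a: "a \<in> set_pmf \<mu>" and fin: "mean_hit c < \<infinity>"
  shows "mean_hit (step c a) < \<infinity>"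
proof (cases "step c a = orig")
  case True
  have "mean_hit orig < \<infinity>" by (rule le_less_trans[OF mean_hit_orig_le]) (simp add: of_nat_less_top)
  then show ?thesis by (simp add: True)
next
  case False
  \<comment> \<open>The average over letters in \<open>avoid (Suc n) c\<close> is bounded below by
    the contribution of the single letter \<open>a\<close>, which does not lead to the
    origin.\<close>
  have "ennreal (pmf \<mu> a) * avoid n (step c a) \<le> avoid (Suc n) c" for n
  proof -
    have "ennreal (pmf \<mu> a) * avoid n (step c a) = (\<integral>\<^sup>+x. avoid n (step c x) * indicator {a} x \<partial>\<mu>)"
      by (subst nn_integral_indicator_singleton) (auto simp: emeasure_pmf_single mult.commute)
    also have "\<dots> \<le> avoid (Suc n) c"
      unfolding avoid.simps by (intro nn_integral_mono) (auto simp: False indicator_def)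
    finally show ?thesis .
  qed
  then have "(\<Sum>n. ennreal (pmf \<mu> a) * avoid n (step c a)) \<le> (\<Sum>n. avoid (Suc n) c)"
    by (intro suminf_le) auto
  also have "\<dots> \<le> mean_hit c" unfolding mean_hit_def
    by (intro suminf_le avoid_Suc_le) auto
  finally have "ennreal (pmf \<mu> a) * mean_hit (step c a) < \<infinity>"
    using fin unfolding mean_hit_def by (simp add: ennreal_suminf_cmult le_less_trans)
  then show ?thesis using a
    by (auto simp: ennreal_mult_less_top pmf_positive set_pmf_iff)
qed

lemma mean_hit_finite: "c \<in> S \<Longrightarrow> mean_hit c < \<infinity>"
proof -
  have *: "mean_hit (foldl step c u) < \<infinity>" if "u \<in> lists (set_pmf \<mu>)" "mean_hit c < \<infinity>" for u c
    using that
  proof (induction u arbitrary: c)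
    case (Cons a u)
    then show ?case using mean_hit_step[of a c] by (simp del: infinity_ennreal_def)
  qed simp
  assume "c \<in> S"
  then obtain u where "u \<in> lists (set_pmf \<mu>)" "foldl step orig u = c" using reach by blast
  then show ?thesis
    using *[of u orig] le_less_trans[OF mean_hit_orig_le] by (auto simp: of_nat_less_top)
qed

lemma avoid_tendsto_0: "c \<in> S \<Longrightarrow> (\<lambda>n. avoid n c) \<longlonglongrightarrow> 0"
proof -
  assume c: "c \<in> S"
  have *: "avoid n c = ennreal (enn2real (avoid n c))" for n
    using le_less_trans[OF avoid_le_1[of n c] ennreal_one_less_top] by simp
  have "(\<Sum>n. ennreal (enn2real (avoid n c))) \<noteq> \<infinity>"
    using mean_hit_finite[OF c] unfolding mean_hit_def *[symmetric] by simp
  then have "summable (\<lambda>n. enn2real (avoid n c))"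
    by (intro summable_suminf_not_top) auto
  from tendsto_ennrealI[OF summable_LIMSEQ_zero[OF this]] show ?thesis
    unfolding *[symmetric] by simp
qed

lemma kac: "mean_hit orig = of_nat (card S)"
proof (rule LIMSEQ_unique)
  have "(\<lambda>N. (\<Sum>n<N. avoid n orig) + (\<Sum>c\<in>S. avoid N c)) \<longlonglongrightarrow> mean_hit orig + (\<Sum>c\<in>S. 0)"
    unfolding mean_hit_def
    by (intro tendsto_add tendsto_sum summable_LIMSEQ avoid_tendsto_0) auto
  then show "(\<lambda>N. (\<Sum>n<N. avoid n orig) + (\<Sum>c\<in>S. avoid N c)) \<longlonglongrightarrow> mean_hit orig" by simp
  show "(\<lambda>N. (\<Sum>n<N. avoid n orig) + (\<Sum>c\<in>S. avoid N c)) \<longlonglongrightarrow> of_nat (card S)"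
    by (simp add: kac_partial)
qed

text \<open>The left side is the mean of the part of the hitting time beyond \<open>n\<close>. Given
  no hit up to \<open>n\<close>, the remaining mean time is that of the current state, and the sum
  of all \<open>mean_hit\<close> values is a crude bound for it that does not depend on the
  state.\<close>

lemma suminf_avoid_add_le:
  "c \<in> S \<Longrightarrow> (\<Sum>m. avoid (n + m) c) \<le> (\<Sum>c\<in>S. mean_hit c) * avoid n c"
proof (induction n arbitrary: c)
  case 0
  then show ?case
    using member_le_sum[of c S mean_hit] finite_S by (simp add: mean_hit_def)
next
  case (Suc n)
  let ?C = "\<Sum>c\<in>S. mean_hit c"
  have "(\<Sum>m. avoid (Suc n + m) c)
      = (\<integral>\<^sup>+a. (\<Sum>m. if step c a = orig then 0 else avoid (n + m) (step c a)) \<partial>\<mu>)"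
    by (simp add: nn_integral_suminf)
  also have "\<dots> \<le> (\<integral>\<^sup>+a. ?C * (if step c a = orig then 0 else avoid n (step c a)) \<partial>\<mu>)"
    using Suc step_S by (intro nn_integral_mono_AE AE_pmfI) auto
  also have "\<dots> = ?C * avoid (Suc n) c" by (simp add: nn_integral_cmult)
  finally show ?case .
qed

text \<open>Letters are read until the first visit to the origin. The recursion need not end on
  every path, so it is set up in sub-probabilities, where the mass of \<open>None\<close> is the
  probability of never hitting.\<close>

partial_function (spmf) hit_spmf :: "'s \<Rightarrow> 'a list spmf" where
  "hit_spmf c = bind_spmf (spmf_of_pmf \<mu>)
     (\<lambda>a. if step c a = orig then return_spmf [a] else map_spmf ((#) a) (hit_spmf (step c a)))"

text \<open>A run that never ends misses the origin in particular during the first \<open>n\<close>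
  steps.\<close>

lemma pmf_hit_spmf_None_le: "ennreal (pmf (hit_spmf c) None) \<le> avoid n c"
proof (induction n arbitrary: c)
  case 0
  then show ?case by (simp add: pmf_le_1)
next
  case (Suc n)
  have "ennreal (pmf (hit_spmf c) None) = (\<integral>\<^sup>+a. ennreal (pmf (if step c a = orig then return_spmf [a]
      else map_spmf ((#) a) (hit_spmf (step c a))) None) \<partial>\<mu>)"
    by (subst hit_spmf.simps) (simp add: ennreal_pmf_bind)
  also have "\<dots> \<le> avoid (Suc n) c"
    unfolding avoid.simps
    by (intro nn_integral_mono) (auto simp: Suc pmf_map_option_None)
  finally show ?case .
qed

lemma None_notin_hit_spmf: "c \<in> S \<Longrightarrow> None \<notin> set_pmf (hit_spmf c)"
proof -
  assume "c \<in> S"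
  then have "ennreal (pmf (hit_spmf c) None) \<le> 0"
    by (intro LIMSEQ_le_const[OF avoid_tendsto_0]) (auto intro: pmf_hit_spmf_None_le)
  then show ?thesis by (simp add: set_pmf_iff ennreal_eq_0_iff)
qed

text \<open>For a state in \<open>S\<close> the value \<open>None\<close> has mass 0, so
  \<open>the\<close> loses nothing.\<close>

definition hit :: "'s \<Rightarrow> 'a list pmf" where "hit c = map_pmf the (hit_spmf c)"

lemma hit_unfold:
  assumes c: "c \<in> S"
  shows "hit c = bind_pmf \<mu>
    (\<lambda>a. if step c a = orig then return_pmf [a] else map_pmf ((#) a) (hit (step c a)))"
proof -
  have "hit c = bind_pmf \<mu> (\<lambda>a. map_pmf the (if step c a = orig then return_spmf [a]
      else map_spmf ((#) a) (hit_spmf (step c a))))"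
    unfolding hit_def by (subst hit_spmf.simps) (simp add: map_bind_pmf)
  also have "\<dots> = bind_pmf \<mu>
    (\<lambda>a. if step c a = orig then return_pmf [a] else map_pmf ((#) a) (hit (step c a)))"
  proof (intro bind_pmf_cong refl)
    fix a assume a: "a \<in> set_pmf \<mu>"
    have "map_pmf the (map_spmf ((#) a) (hit_spmf (step c a))) = map_pmf ((#) a) (hit (step c a))"
      unfolding hit_def pmf.map_comp
    proof (intro map_pmf_cong refl)
      fix x assume "x \<in> set_pmf (hit_spmf (step c a))"
      then obtain w where "x = Some w" using None_notin_hit_spmf[OF step_S[OF c a]] by (cases x) auto
      then show "(the \<circ> map_option ((#) a)) x = ((#) a \<circ> the) x" by simp
    qed
    then show "map_pmf the (if step c a = orig then return_spmf [a]
      else map_spmf ((#) a) (hit_spmf (step c a))) =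
      (if step c a = orig then return_pmf [a] else map_pmf ((#) a) (hit (step c a)))"
      by simp
  qed
  finally show ?thesis .
qed

lemma hit_tail: "c \<in> S \<Longrightarrow> (\<integral>\<^sup>+w. (if n < length w then 1 else 0) \<partial>hit c) = avoid n c"
proof (induction n arbitrary: c)
  case 0
  have "(\<integral>\<^sup>+w. (if 0 < length w then 1 else 0) \<partial>hit c)
     = (\<integral>\<^sup>+a. 1 \<partial>\<mu>)"
    unfolding hit_unfold[OF 0] nn_integral_bind_pmf
    by (intro nn_integral_cong_AE AE_pmfI) auto
  then show ?case by simp
next
  case (Suc n)
  show ?case
    unfolding hit_unfold[OF Suc.prems] nn_integral_bind_pmf avoid.simps
    using Suc.IH step_S Suc.prems by (intro nn_integral_cong_AE AE_pmfI) auto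
qed

lemma mean_length_hit: "c \<in> S \<Longrightarrow> (\<integral>\<^sup>+w. of_nat (length w) \<partial>hit c) = mean_hit c"
proof -
  assume c: "c \<in> S"
  have "(\<integral>\<^sup>+w. of_nat (length w) \<partial>hit c) = (\<integral>\<^sup>+w. (\<Sum>n. if n < length w then 1 else 0) \<partial>hit c)"
    by (simp add: suminf_less_length)
  also have "\<dots> = mean_hit c"
    by (subst nn_integral_suminf) (simp_all add: hit_tail c mean_hit_def)
  finally show ?thesis .
qed

text \<open>The square of the length is at most twice the number of pairs \<open>(n, m)\<close> with
  \<open>n + m\<close> below the length. In the mean this is a double tail sum; its inner sum is at
  most a constant times \<open>avoid n c\<close>, and the outer sum is then that constant times
  \<open>mean_hit c\<close>.\<close>

lemma second_moment_hit: "c \<in> S \<Longrightarrow> (\<integral>\<^sup>+w. of_nat ((length w)\<^sup>2) \<partial>hit c) < \<infinity>"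
proof -
  assume c: "c \<in> S"
  let ?C = "\<Sum>c\<in>S. mean_hit c"
  have C: "?C < \<infinity>" using mean_hit_finite finite_S by simp
  have inner: "(\<Sum>m. if n + m < L then 1 else (0::ennreal)) = of_nat (L - n)" for n L :: nat
  proof -
    have "(n + m < L) = (m < L - n)" for m by auto
    then have "(\<Sum>m. if n + m < L then 1 else (0::ennreal)) = (\<Sum>m<L - n. 1::ennreal)"
      by (simp only: suminf_less_length)
    then show ?thesis by simp
  qed
  have *: "of_nat (L\<^sup>2) \<le> 2 * (\<Sum>n. \<Sum>m. if n + m < L then 1 else (0::ennreal))" for L
  proof -
    have "(\<Sum>n. \<Sum>m. if n + m < L then 1 else (0::ennreal)) = (\<Sum>n. if n < L then of_nat (L - n) else 0)"
      by (intro suminf_cong) (auto simp: inner)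
    also have "\<dots> = of_nat (\<Sum>n<L. L - n)" by (simp add: suminf_less_length)
    finally have "2 * (\<Sum>n. \<Sum>m. if n + m < L then 1 else (0::ennreal)) = of_nat (2 * (\<Sum>n<L. L - n))"
      by simp
    moreover have "(of_nat (L\<^sup>2) :: ennreal) \<le> of_nat (2 * (\<Sum>n<L. L - n))"
      by (rule of_nat_mono) (rule square_le_sum)
    ultimately show ?thesis by simp
  qed
  have "(\<integral>\<^sup>+w. of_nat ((length w)\<^sup>2) \<partial>hit c)
      \<le> (\<integral>\<^sup>+w. 2 * (\<Sum>n. \<Sum>m. if n + m < length w then 1 else 0) \<partial>hit c)"
    by (intro nn_integral_mono *)
  also have "\<dots> = 2 * (\<Sum>n. \<Sum>m. avoid (n + m) c)"
    by (simp add: nn_integral_cmult nn_integral_suminf hit_tail c)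
  also have "\<dots> \<le> 2 * (\<Sum>n. ?C * avoid n c)"
    by (intro mult_left_mono suminf_le suminf_avoid_add_le c) auto
  also have "\<dots> = 2 * (?C * mean_hit c)" by (simp add: mean_hit_def)
  also have "\<dots> < \<infinity>" using C mean_hit_finite[OF c] by (simp add: ennreal_mult_less_top)
  finally show ?thesis .
qed

end

section \<open>Words read up to a stopping time and Wald's identity\<close>

text \<open>The law of a word of i.i.d. letters read up to a stopping time: topping it up with fresh letters
  gives back the i.i.d. sequence, and whether an \<open>i\<close>-th letter is read is independent of its value.\<close>

definition stopping_law :: "'a pmf \<Rightarrow> 'a list pmf \<Rightarrow> bool" where
  "stopping_law \<mu> W \<longleftrightarrow>
     (\<forall>n. bind_pmf W (\<lambda>w. map_pmf (\<lambda>v. take n (w @ v)) (replicate_pmf (n - length w) \<mu>))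
        = replicate_pmf n \<mu>) \<and>
     (\<forall>i f. (\<integral>\<^sup>+w. (if i < length w then f (w ! i) else 0) \<partial>W)
        = (\<integral>\<^sup>+w. (if i < length w then 1 else 0) \<partial>W) * (\<integral>\<^sup>+a. f a \<partial>\<mu>))"

lemma stopping_law_Nil: "stopping_law \<mu> (return_pmf [])"
proof -
  have "map_pmf (take n) (replicate_pmf n \<mu>) = replicate_pmf n \<mu>" for n
  proof -
    have "map_pmf (take n) (replicate_pmf n \<mu>) = map_pmf id (replicate_pmf n \<mu>)"
      by (intro map_pmf_cong refl) (auto simp: set_replicate_pmf)
    then show ?thesis by simp
  qed
  then show ?thesis by (simp add: stopping_law_def bind_return_pmf)
qed

lemma stopping_lawD_take:
  "stopping_law \<mu> W \<Longrightarrow>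
    bind_pmf W (\<lambda>w. map_pmf (\<lambda>v. take n (w @ v)) (replicate_pmf (n - length w) \<mu>)) = replicate_pmf n \<mu>"
  by (simp add: stopping_law_def)

lemma stopping_lawD_wald:
  "stopping_law \<mu> W \<Longrightarrow>
    (\<integral>\<^sup>+w. (if i < length w then f (w ! i) else 0) \<partial>W)
      = (\<integral>\<^sup>+w. (if i < length w then 1 else 0) \<partial>W) * (\<integral>\<^sup>+a. f a \<partial>\<mu>)"
  by (simp add: stopping_law_def)

lemma replicate_pmf_Suc_map:
  "replicate_pmf (Suc n) p = bind_pmf p (\<lambda>a. map_pmf ((#) a) (replicate_pmf n p))"
  by (simp add: map_pmf_def)

lemma sum_list_drop_eq:
  fixes f :: "'a \<Rightarrow> ennreal"
  shows "(\<Sum>a\<leftarrow>drop n w. f a) = (\<Sum>i. if n + i < length w then f (w ! (n + i)) else 0)"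
proof -
  have "(n + i < length w) = (i < length w - n)" for i by auto
  then have "(\<Sum>i. if n + i < length w then f (w ! (n + i)) else 0) = (\<Sum>i<length w - n. f (w ! (n + i)))"
    by (subst suminf_finite[of "{..<length w - n}"]) auto
  then show ?thesis by (simp add: sum_list_sum_nth atLeast0LessThan)
qed

lemma wald_drop:
  fixes f :: "'a \<Rightarrow> ennreal"
  assumes "stopping_law \<mu> W"
  shows "(\<integral>\<^sup>+w. (\<Sum>a\<leftarrow>drop n w. f a) \<partial>W) = (\<integral>\<^sup>+w. of_nat (length w - n) \<partial>W) * (\<integral>\<^sup>+a. f a \<partial>\<mu>)"
proof -
  \<comment> \<open>Proved for every \<open>f\<close>, because the choice \<open>f = 1\<close>
    identifies the sum of tail probabilities with the mean number of letters read after time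
    \<open>n\<close>.\<close>
  have *: "(\<integral>\<^sup>+w. (\<Sum>a\<leftarrow>drop n w. f a) \<partial>W)
      = (\<Sum>i. \<integral>\<^sup>+w. (if n + i < length w then 1 else 0) \<partial>W) * (\<integral>\<^sup>+a. f a \<partial>\<mu>)" for f
    unfolding sum_list_drop_eq
    by (simp add: nn_integral_suminf stopping_lawD_wald[OF assms])
  have "(\<integral>\<^sup>+w. of_nat (length w - n) \<partial>W) = (\<integral>\<^sup>+w. (\<Sum>a\<leftarrow>drop n w. 1) \<partial>W)"
    by (simp add: sum_list_triv)
  then show ?thesis using *[of f] *[of "\<lambda>_. 1"] by simp
qed

lemma wald_replicate:
  fixes f :: "'a \<Rightarrow> ennreal"
  shows "(\<integral>\<^sup>+v. (\<Sum>a\<leftarrow>v. f a) \<partial>replicate_pmf m \<mu>) = of_nat m * (\<integral>\<^sup>+a. f a \<partial>\<mu>)"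
  by (induction m) (simp_all add: replicate_pmf_Suc_map nn_integral_add distrib_right add.commute
        del: replicate_pmf.simps(2))

section \<open>The k-th return time: stopping law, mean and deviation\<close>

context bijective_walk
begin

lemma hit_append_unfold:
  assumes c: "c \<in> S"
  shows "bind_pmf (hit c) (\<lambda>w. map_pmf ((@) w) V) = bind_pmf \<mu> (\<lambda>a. map_pmf ((#) a)
    (if step c a = orig then V else bind_pmf (hit (step c a)) (\<lambda>w. map_pmf ((@) w) V)))"
proof -
  have [simp]: "(@) [a] = (#) a" "(@) (a # w) = (\<lambda>v. a # (w @ v))" for a and w :: "'a list"
    by auto
  show ?thesis
    unfolding hit_unfold[OF c] bind_assoc_pmf
    by (intro bind_pmf_cong refl)
       (auto simp: bind_return_pmf map_bind_pmf bind_map_pmf pmf.map_comp comp_def)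
qed

text \<open>Both properties are proved by induction on the number of letters inspected, for all
  starting states at once. After one free letter the rest is again of the form \<open>F\<close>, or
  it is \<open>V\<close> if the origin has been hit.\<close>

lemma stopping_law_hit_append:
  assumes V: "stopping_law \<mu> V" and c: "c \<in> S"
  shows "stopping_law \<mu> (bind_pmf (hit c) (\<lambda>w. map_pmf ((@) w) V))"
proof -
  define F where "F c = bind_pmf (hit c) (\<lambda>w. map_pmf ((@) w) V)" for c
  have F: "F c = bind_pmf \<mu> (\<lambda>a. map_pmf ((#) a) (if step c a = orig then V else F (step c a)))"
    if "c \<in> S" for c
    unfolding F_def by (rule hit_append_unfold[OF that])
  let ?K = "\<lambda>n w. map_pmf (\<lambda>v. take n (w @ v)) (replicate_pmf (n - length w) \<mu>)"
  have 1: "bind_pmf (F c) (?K n) = replicate_pmf n \<mu>" if "c \<in> S" for n c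
    using that
  proof (induction n arbitrary: c)
    case (Suc n)
    have "bind_pmf (F c) (?K (Suc n))
      = bind_pmf \<mu> (\<lambda>a. bind_pmf (if step c a = orig then V else F (step c a)) (\<lambda>w. map_pmf ((#) a) (?K n w)))"
      by (simp add: F[OF Suc.prems] bind_assoc_pmf bind_map_pmf pmf.map_comp comp_def del: take_append)
    also have "\<dots> = bind_pmf \<mu> (\<lambda>a. map_pmf ((#) a) (replicate_pmf n \<mu>))"
      using Suc.IH Suc.prems step_S
      by (intro bind_pmf_cong refl)
         (auto simp: map_bind_pmf[symmetric] stopping_lawD_take[OF V] simp del: take_append)
    finally show ?case unfolding replicate_pmf_Suc_map .
  qed simp
  have 2: "(\<integral>\<^sup>+w. (if i < length w then f (w ! i) else 0) \<partial>F c)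
      = (\<integral>\<^sup>+w. (if i < length w then 1 else 0) \<partial>F c) * (\<integral>\<^sup>+a. f a \<partial>\<mu>)" if "c \<in> S" for i c f
    using that
  proof (induction i arbitrary: c)
    case 0
    then show ?case by (simp add: F)
  next
    case (Suc i)
    have "(\<integral>\<^sup>+w. (if Suc i < length w then f (w ! Suc i) else 0) \<partial>F c)
        = (\<integral>\<^sup>+a. (\<integral>\<^sup>+w. (if i < length w then 1 else 0) \<partial>(if step c a = orig then V else F (step c a)))
              * (\<integral>\<^sup>+a. f a \<partial>\<mu>) \<partial>\<mu>)"
      unfolding F[OF Suc.prems] nn_integral_bind_pmf nn_integral_map_pmf
      using Suc.IH Suc.prems step_S stopping_lawD_wald[OF V]
      by (intro nn_integral_cong_AE AE_pmfI) (auto cong: if_cong)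
    then show ?case unfolding F[OF Suc.prems] by (simp add: nn_integral_multc)
  qed
  show ?thesis unfolding stopping_law_def using 1 2 c by (auto simp: F_def)
qed

text \<open>Independent return words are concatenated: this is the law of the word read up to the
  k-th return.\<close>

primrec blocks :: "nat \<Rightarrow> 'a list pmf" where
  "blocks 0 = return_pmf []"
| "blocks (Suc k) = bind_pmf (hit orig) (\<lambda>w. map_pmf ((@) w) (blocks k))"

lemma stopping_law_blocks: "stopping_law \<mu> (blocks k)"
  by (induction k) (auto intro: stopping_law_Nil stopping_law_hit_append orig_S)

lemma mean_length_blocks: "(\<integral>\<^sup>+w. of_nat (length w) \<partial>blocks k) = of_nat (card S * k)"
  by (induction k) (simp_all add: nn_integral_add mean_length_hit[OF orig_S] kac)

text \<open>Additivity of the variance over independent blocks: the variance of the k-th return time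
  is k times that of the first. The squared means are moved across so that no difference
  occurs.\<close>

lemma second_moment_blocks:
  "(\<integral>\<^sup>+w. of_nat ((length w)\<^sup>2) \<partial>blocks k) + of_nat (k * (card S)\<^sup>2)
     = of_nat k * (\<integral>\<^sup>+w. of_nat ((length w)\<^sup>2) \<partial>hit orig) + of_nat ((card S * k)\<^sup>2)"
proof (induction k)
  case (Suc k)
  let ?v = "\<integral>\<^sup>+w. of_nat ((length w)\<^sup>2) \<partial>hit orig"
  let ?m = "\<integral>\<^sup>+w. of_nat ((length w)\<^sup>2) \<partial>blocks k"
  have sq: "(of_nat ((x + y)\<^sup>2) :: ennreal) = of_nat (x\<^sup>2) + (2 * (of_nat x * of_nat y) + of_nat (y\<^sup>2))" for x y :: nat
    unfolding power2_sum by (simp add: algebra_simps)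
  have "(\<integral>\<^sup>+w. of_nat ((length w)\<^sup>2) \<partial>blocks (Suc k))
      = ?v + (2 * (of_nat (card S) * of_nat (card S * k)) + ?m)"
    unfolding blocks.simps nn_integral_bind_pmf nn_integral_map_pmf length_append sq
    by (simp add: nn_integral_add nn_integral_cmult nn_integral_multc mean_length_blocks mean_length_hit[OF orig_S] kac
        del: of_nat_mult of_nat_power)
  also have "\<dots> + of_nat (Suc k * (card S)\<^sup>2)
      = ?v + of_nat (2 * (card S)\<^sup>2 * k + (card S)\<^sup>2) + (?m + of_nat (k * (card S)\<^sup>2))"
    by (simp add: algebra_simps power2_eq_square)
  also have "\<dots> = of_nat (Suc k) * ?v + of_nat ((card S * Suc k)\<^sup>2)"
    unfolding Suc by (simp add: algebra_simps power2_eq_square mult_2_right mult_2)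
  finally show ?case .
qed simp

text \<open>With truncated subtraction, \<open>x - n + (n - x)\<close> is the distance of
  \<open>x\<close> and \<open>n\<close>. Since the mean length is \<open>card S * k\<close>, the
  left side is the variance, bounded by k second moments of a single block.\<close>

lemma square_deviation_blocks:
  "(\<integral>\<^sup>+w. of_nat ((length w - card S * k + (card S * k - length w))\<^sup>2) \<partial>blocks k)
     \<le> of_nat k * (\<integral>\<^sup>+w. of_nat ((length w)\<^sup>2) \<partial>hit orig)"
proof -
  let ?n = "card S * k"
  let ?v = "\<integral>\<^sup>+w. of_nat ((length w)\<^sup>2) \<partial>hit orig"
  let ?D = "\<integral>\<^sup>+w. of_nat ((length w - ?n + (?n - length w))\<^sup>2) \<partial>blocks k"
  let ?m = "\<integral>\<^sup>+w. of_nat ((length w)\<^sup>2) \<partial>blocks k"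
  have "(x - n + (n - x))\<^sup>2 + 2 * n * x = x\<^sup>2 + n\<^sup>2" for x n :: nat
  proof (cases "x \<le> n")
    case True
    then obtain y where "n = x + y" using le_Suc_ex by blast
    then show ?thesis by (simp add: power2_eq_square algebra_simps)
  next
    case False
    then obtain y where "x = n + y" using le_Suc_ex[of n x] by auto
    then show ?thesis by (simp add: power2_eq_square algebra_simps)
  qed
  then have eq: "(of_nat ((x - n + (n - x))\<^sup>2) :: ennreal) + of_nat (2 * n) * of_nat x = of_nat (x\<^sup>2) + of_nat (n\<^sup>2)"
    for x n :: nat by (metis of_nat_add of_nat_mult)
  have "?D + of_nat (2 * ?n) * of_nat ?n = (\<integral>\<^sup>+w. of_nat ((length w - ?n + (?n - length w))\<^sup>2)
          + of_nat (2 * ?n) * of_nat (length w) \<partial>blocks k)"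
    by (simp add: nn_integral_add nn_integral_cmult mean_length_blocks del: of_nat_mult of_nat_power of_nat_add)
  also have "\<dots> = ?m + of_nat (?n\<^sup>2)"
    unfolding eq by (simp add: nn_integral_add del: of_nat_mult of_nat_power)
  finally have "?D + of_nat (2 * ?n) * of_nat ?n = ?m + of_nat (?n\<^sup>2)" .
  moreover have "of_nat (2 * ?n) * of_nat ?n = (of_nat (?n\<^sup>2) + of_nat (?n\<^sup>2) :: ennreal)"
    unfolding of_nat_mult[symmetric] of_nat_add[symmetric]
    by (rule arg_cong[where f = of_nat]) (simp add: power2_eq_square)
  ultimately have "?D + of_nat (?n\<^sup>2) + of_nat (?n\<^sup>2) = ?m + of_nat (?n\<^sup>2)"
    by (simp only: add.assoc)
  moreover have fin: "of_nat x \<noteq> (\<infinity> :: ennreal)" for x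
    unfolding infinity_ennreal_def by (rule ennreal_of_nat_neq_top)
  ultimately have "of_nat (?n\<^sup>2) + ?D = ?m"
    by (simp only: add.commute[of _ "of_nat (?n\<^sup>2)"] ennreal_add_left_cancel simp_thms)
  also have "\<dots> \<le> ?m + of_nat (k * (card S)\<^sup>2)" by simp
  also have "\<dots> = of_nat (?n\<^sup>2) + of_nat k * ?v"
    unfolding second_moment_blocks by (rule add.commute)
  finally show ?thesis
    unfolding ennreal_add_left_cancel_le using fin by blast
qed

lemma deviation_blocks:
  "\<exists>C\<ge>0. \<forall>k. (\<integral>\<^sup>+w. of_nat (length w - card S * k + (card S * k - length w)) \<partial>blocks k)
     \<le> ennreal (C * sqrt (real k))"
proof -
  let ?v = "\<integral>\<^sup>+w. of_nat ((length w)\<^sup>2) \<partial>hit orig"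
  have "?v < \<infinity>" by (rule second_moment_hit[OF orig_S])
  then obtain v where v: "0 \<le> v" "?v = ennreal v" by (cases ?v) auto
  show ?thesis
  proof (intro exI[of _ "v + 1"] conjI allI)
    fix k
    let ?d = "\<lambda>w. length w - card S * k + (card S * k - length w)"
    show "(\<integral>\<^sup>+w. of_nat (?d w) \<partial>blocks k) \<le> ennreal ((v + 1) * sqrt (real k))"
    proof (cases "k = 0")
      case False
      define t where "t = sqrt (real k)"
      have t: "0 < t" "t * t = real k" using False by (auto simp: t_def)
      \<comment> \<open>A pointwise replacement for the Cauchy-Schwarz inequality: either
        \<open>D \<le> t\<close>, or \<open>D\<close> is at most its square divided by
        \<open>t\<close>. The choice of t as the root of \<open>k\<close> balances both terms and
        gives the constant \<open>v + 1\<close>.\<close>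
      have pt: "(of_nat D :: ennreal) \<le> ennreal (1 / t) * of_nat (D\<^sup>2) + ennreal t" for D :: nat
      proof -
        have "real D \<le> 1 / t * (real D)\<^sup>2 + t"
        proof (cases "real D \<le> t")
          case True
          moreover have "0 \<le> 1 / t * (real D)\<^sup>2" using t by simp
          ultimately show ?thesis by linarith
        next
          case False
          then have "real D * t \<le> real D * real D" by (intro mult_left_mono) auto
          then have "real D \<le> 1 / t * (real D)\<^sup>2" using t by (simp add: field_simps power2_eq_square)
          then show ?thesis using t by simp
        qed
        then have "ennreal (real D) \<le> ennreal (1 / t * (real D)\<^sup>2 + t)" by (rule ennreal_leI)
        also have "\<dots> = ennreal (1 / t) * ennreal (real (D\<^sup>2)) + ennreal t"
          using t by (simp add: ennreal_plus ennreal_mult del: times_divide_eq_left times_divide_eq_right mult_1)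
        finally show ?thesis by (simp only: ennreal_of_nat_eq_real_of_nat)
      qed
      have "(\<integral>\<^sup>+w. of_nat (?d w) \<partial>blocks k)
          \<le> (\<integral>\<^sup>+w. ennreal (1 / t) * of_nat ((?d w)\<^sup>2) + ennreal t \<partial>blocks k)"
        by (intro nn_integral_mono pt)
      also have "\<dots> = ennreal (1 / t) * (\<integral>\<^sup>+w. of_nat ((?d w)\<^sup>2) \<partial>blocks k) + ennreal t"
        by (simp add: nn_integral_add nn_integral_cmult del: of_nat_power of_nat_add)
      also have "\<dots> \<le> ennreal (1 / t) * (of_nat k * ennreal v) + ennreal t"
        using square_deviation_blocks[of k] unfolding v(2) by (intro add_right_mono mult_left_mono) auto
      also have "\<dots> = ennreal (1 / t * (real k * v) + t)"
        using t v by (simp add: ennreal_of_nat_eq_real_of_nat ennreal_mult'[symmetric])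
      also have "1 / t * (real k * v) + t = (v + 1) * t"
        using t by (simp add: t(2)[symmetric] field_simps)
      finally show ?thesis by (simp add: t_def)
    qed simp
  qed (use v in auto)
qed

end

section \<open>Entropy and convolution in terms of probability mass functions\<close>

text \<open>The sum is a supremum over finite subsets. Finite initial segments of an enumeration
  exhaust \<open>A\<close>, and monotone convergence along them gives the harder inequality.\<close>

lemma infsum_eq_nn_integral:
  fixes f :: "'a \<Rightarrow> ennreal"
  assumes "countable A"
  shows "infsum f A = (\<integral>\<^sup>+x. f x \<partial>count_space A)"
proof -
  have fin: "sum f F = (\<integral>\<^sup>+x. f x * indicator F x \<partial>count_space A)" if "F \<subseteq> A" "finite F" for F
  proof -
    have "sum f F = (\<integral>\<^sup>+x. f x * indicator F x \<partial>count_space F)"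
      using that by (simp add: nn_integral_count_space_finite)
    also have "\<dots> = (\<integral>\<^sup>+x. f x * indicator F x \<partial>count_space A)"
      using that by (intro nn_integral_count_space_eq) auto
    finally show ?thesis .
  qed
  have sup: "infsum f A = (SUP F\<in>{F. finite F \<and> F \<subseteq> A}. sum f F)"
    by (rule nonneg_infsum_complete) simp
  show ?thesis
  proof (rule antisym)
    show "infsum f A \<le> (\<integral>\<^sup>+x. f x \<partial>count_space A)"
      unfolding sup by (rule SUP_least) (auto simp: fin indicator_def intro!: nn_integral_mono)
    show "(\<integral>\<^sup>+x. f x \<partial>count_space A) \<le> infsum f A"
    proof (cases "A = {}")
      case False
      define F where "F n = from_nat_into A ` {..<n}" for n
      have F: "F n \<subseteq> A" "finite (F n)" for n
        using from_nat_into[OF False] by (auto simp: F_def)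
      have "(\<integral>\<^sup>+x. f x \<partial>count_space A) = (\<integral>\<^sup>+x. (SUP n. f x * indicator (F n) x) \<partial>count_space A)"
      proof (intro nn_integral_cong)
        fix x assume "x \<in> space (count_space A)"
        then obtain i where i: "x = from_nat_into A i" using assms False
          by (metis from_nat_into_surj space_count_space)
        show "f x = (SUP n. f x * indicator (F n) x)"
        proof (rule antisym)
          show "f x \<le> (SUP n. f x * indicator (F n) x)"
            by (rule SUP_upper2[of "Suc i"]) (auto simp: F_def i)
          show "(SUP n. f x * indicator (F n) x) \<le> f x"
            by (rule SUP_least) (auto simp: indicator_def)
        qed
      qed
      also have "\<dots> = (SUP n. \<integral>\<^sup>+x. f x * indicator (F n) x \<partial>count_space A)"
        by (rule nn_integral_monotone_convergence_SUP)
           (auto simp: incseq_def le_fun_def F_def indicator_def)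
      also have "\<dots> = (SUP n. sum f (F n))" by (simp add: fin F)
      also have "\<dots> \<le> infsum f A" unfolding sup
        by (rule SUP_mono) (use F in auto)
      finally show ?thesis .
    qed (simp add: nn_integral_empty)
  qed
qed

lemma entropy_on_eq_entropy_pmf:
  assumes "countable (carrier G)" "set_pmf p \<subseteq> carrier G" "\<And>g. g \<in> carrier G \<Longrightarrow> f g = pmf p g"
  shows "entropy_on G f = entropy_pmf p"
proof -
  \<comment> \<open>At a point of mass 0 the right side is 0 times \<infinity>, which is 0 and
    agrees with the convention for 0 log 0.\<close>
  have eq: "ennreal (- (pmf p x * ln (pmf p x))) = ennreal (pmf p x) * neg_ln (pmf p x)" for x
  proof (cases "pmf p x = 0")
    case False
    then have "0 < pmf p x" by (simp add: less_le)
    then show ?thesis by (simp add: neg_ln_def ennreal_mult'[symmetric])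
  qed simp
  have "entropy_on G f = (\<Sum>\<^sub>\<infinity>g\<in>carrier G. ennreal (- (pmf p g * ln (pmf p g))))"
    unfolding entropy_on_def by (intro infsum_cong) (simp add: assms(3))
  also have "\<dots> = (\<integral>\<^sup>+x. ennreal (pmf p x) * neg_ln (pmf p x) \<partial>count_space (carrier G))"
    unfolding eq by (simp add: infsum_eq_nn_integral assms(1))
  also have "\<dots> = (\<integral>\<^sup>+x. ennreal (pmf p x) * neg_ln (pmf p x) \<partial>count_space UNIV)"
    using assms(2) by (intro nn_integral_count_space_eq) (auto simp: set_pmf_iff)
  also have "\<dots> = entropy_pmf p" unfolding entropy_pmf_def by (rule nn_integral_measure_pmf[symmetric])
  finally show ?thesis .
qed

definition (in monoid) word_prod :: "'a list \<Rightarrow> 'a" where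
  "word_prod u = foldr (\<otimes>) u \<one>"

context monoid
begin

lemma word_prod_simps [simp]: "word_prod [] = \<one>" "word_prod (a # u) = a \<otimes> word_prod u"
  by (simp_all add: word_prod_def)

lemma word_prod_closed [simp]: "set u \<subseteq> carrier G \<Longrightarrow> word_prod u \<in> carrier G"
  by (induction u) auto

lemma word_prod_append:
  "set u \<subseteq> carrier G \<Longrightarrow> set v \<subseteq> carrier G \<Longrightarrow> word_prod (u @ v) = word_prod u \<otimes> word_prod v"
  by (induction u) (auto simp: m_assoc)

end

context group
begin

definition walk_pmf :: "'a pmf \<Rightarrow> nat \<Rightarrow> 'a pmf" where
  "walk_pmf p n = map_pmf word_prod (replicate_pmf n p)"

lemma set_walk_pmf: "set_pmf p \<subseteq> carrier G \<Longrightarrow> set_pmf (walk_pmf p n) \<subseteq> carrier G"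
  by (auto simp: walk_pmf_def set_replicate_pmf intro!: word_prod_closed)

lemma walk_pmf_add:
  assumes p: "set_pmf p \<subseteq> carrier G"
  shows "walk_pmf p (m + n) = bind_pmf (walk_pmf p m) (\<lambda>x. map_pmf ((\<otimes>) x) (walk_pmf p n))"
proof -
  have "walk_pmf p (m + n)
     = bind_pmf (replicate_pmf m p) (\<lambda>xs. bind_pmf (replicate_pmf n p) (\<lambda>ys. return_pmf (word_prod (xs @ ys))))"
    by (simp add: walk_pmf_def replicate_pmf_distrib map_bind_pmf)
  also have "\<dots> = bind_pmf (replicate_pmf m p) (\<lambda>xs. bind_pmf (replicate_pmf n p)
      (\<lambda>ys. return_pmf (word_prod xs \<otimes> word_prod ys)))"
    using p by (intro bind_pmf_cong refl arg_cong[where f = return_pmf] word_prod_append)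
               (auto simp: set_replicate_pmf)
  finally show ?thesis
    by (simp add: walk_pmf_def bind_map_pmf pmf.map_comp comp_def) (simp add: map_pmf_def)
qed

lemma walk_pmf_1: "set_pmf p \<subseteq> carrier G \<Longrightarrow> walk_pmf p 1 = p"
proof -
  assume p: "set_pmf p \<subseteq> carrier G"
  have "walk_pmf p 1 = map_pmf (\<lambda>x. x \<otimes> \<one>) p"
    unfolding walk_pmf_def replicate_pmf_1 pmf.map_comp by (simp add: comp_def)
  also have "\<dots> = map_pmf id p" using p by (intro map_pmf_cong refl) auto
  finally show ?thesis by simp
qed

lemma convolution_on_pmf:
  assumes p: "set_pmf p \<subseteq> carrier G" and q: "set_pmf q \<subseteq> carrier G" and g: "g \<in> carrier G"
  shows "convolution_on G (pmf p) (pmf q) g = pmf (bind_pmf p (\<lambda>x. map_pmf ((\<otimes>) x) q)) g"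
proof -
  have trans: "pmf (map_pmf ((\<otimes>) x) q) g = pmf q (inv x \<otimes> g)" if x: "x \<in> carrier G" for x
  proof -
    have "x \<otimes> y = g \<longleftrightarrow> y = inv x \<otimes> g" if "y \<in> carrier G" for y
      unfolding inv_solve_left[OF that x g] by (rule eq_commute)
    moreover have "inv x \<otimes> g \<in> carrier G" using x g by simp
    ultimately have eq: "{y \<in> carrier G. x \<otimes> y = g} = {inv x \<otimes> g}"
      by blast
    have "pmf (map_pmf ((\<otimes>) x) q) g = measure (measure_pmf q) ((\<otimes>) x -` {g})"
      by (simp add: pmf_map)
    \<comment> \<open>Multiplication is unspecified outside the carrier, so the preimage is cut down
      to the carrier, which has full mass under \<open>q\<close>.\<close>
    also have "\<dots> = measure (measure_pmf q) {y \<in> carrier G. x \<otimes> y = g}"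
      using q by (intro measure_prob_cong_0) (auto simp: set_pmf_iff)
    finally show ?thesis by (simp add: eq measure_pmf_single)
  qed
  let ?h = "\<lambda>x. pmf p x * pmf q (inv x \<otimes> g)"
  have "integrable (count_space (carrier G)) (pmf p)"
    by (rule integrable_pmf)
  then have int: "integrable (count_space (carrier G)) ?h"
    by (rule Bochner_Integration.integrable_bound) (auto simp: mult_left_le pmf_le_1)
  then have "convolution_on G (pmf p) (pmf q) g = infsetsum ?h (carrier G)"
    unfolding convolution_on_def
    by (subst infsetsum_infsum) (auto simp: abs_summable_on_def simp flip: abs_summable_equivalent)
  also have "ennreal \<dots> = (\<integral>\<^sup>+x. ?h x \<partial>count_space (carrier G))"
    unfolding infsetsum_def by (rule nn_integral_eq_integral[OF int, symmetric]) simp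
  also have "\<dots> = (\<integral>\<^sup>+x. ennreal (pmf p x) * pmf (map_pmf ((\<otimes>) x) q) g \<partial>count_space (carrier G))"
    by (intro nn_integral_cong) (simp add: trans ennreal_mult)
  also have "\<dots> = (\<integral>\<^sup>+x. ennreal (pmf p x) * pmf (map_pmf ((\<otimes>) x) q) g \<partial>count_space UNIV)"
    using p by (intro nn_integral_count_space_eq) (auto simp: set_pmf_iff)
  also have "\<dots> = pmf (bind_pmf p (\<lambda>x. map_pmf ((\<otimes>) x) q)) g"
    unfolding ennreal_pmf_bind by (rule nn_integral_measure_pmf[symmetric])
  finally show ?thesis by (simp add: convolution_on_def infsum_nonneg)
qed

lemma convolution_power_eq_walk_pmf:
  assumes p: "set_pmf p \<subseteq> carrier G" and f: "\<And>g. g \<in> carrier G \<Longrightarrow> f g = pmf p g"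
  shows "g \<in> carrier G \<Longrightarrow> convolution_power G f n g = pmf (walk_pmf p n) g"
proof (induction n arbitrary: g)
  case 0
  then show ?case by (simp add: walk_pmf_def indicator_def pmf_return)
next
  case (Suc n)
  have "convolution_power G f (Suc n) g = convolution_on G (pmf (walk_pmf p n)) (pmf p) g"
    unfolding convolution_power.simps convolution_on_def
    by (intro infsum_cong) (simp add: Suc f)
  also have "\<dots> = pmf (walk_pmf p (n + 1)) g"
    by (simp only: convolution_on_pmf[OF set_walk_pmf[OF p] p Suc.prems] walk_pmf_add[OF p] walk_pmf_1[OF p])
  finally show ?case by simp
qed

lemma entropy_on_convolution_power:
  assumes "countable (carrier G)" "set_pmf p \<subseteq> carrier G" "\<And>g. g \<in> carrier G \<Longrightarrow> f g = pmf p g"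
  shows "entropy_on G (convolution_power G f n) = entropy_pmf (walk_pmf p n)"
  by (intro entropy_on_eq_entropy_pmf assms set_walk_pmf convolution_power_eq_walk_pmf)

text \<open>The two stretches of the walk are independent, and the final position is a function of
  the pair. This is the subadditivity that Fekete's lemma needs.\<close>

lemma entropy_walk_pmf_add_le:
  assumes p: "set_pmf p \<subseteq> carrier G"
  shows "entropy_pmf (walk_pmf p (m + n)) \<le> entropy_pmf (walk_pmf p m) + entropy_pmf (walk_pmf p n)"
proof -
  have "walk_pmf p (m + n) = map_pmf (\<lambda>(x, y). x \<otimes> y) (pair_pmf (walk_pmf p m) (walk_pmf p n))"
    unfolding walk_pmf_add[OF p] by (simp add: pair_pmf_def map_bind_pmf) (simp add: map_pmf_def)
  then show ?thesis
    using entropy_map_pmf_le by (metis entropy_pair_pmf)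
qed

lemma entropy_walk_pmf_finite:
  assumes p: "set_pmf p \<subseteq> carrier G" and H: "entropy_pmf p < \<infinity>"
  shows "entropy_pmf (walk_pmf p n) < \<infinity>"
proof (induction n)
  case 0
  then show ?case by (simp add: walk_pmf_def entropy_return_pmf)
next
  case (Suc n)
  have "entropy_pmf (walk_pmf p (n + 1)) \<le> entropy_pmf (walk_pmf p n) + entropy_pmf p"
    using entropy_walk_pmf_add_le[OF p, of n 1] by (simp only: walk_pmf_1[OF p])
  also have "\<dots> < \<infinity>" using Suc H by simp
  finally show ?case by simp
qed

section \<open>Coupling the walk at a stopping time with the walk at a fixed time\<close>

text \<open>The word at a stopping time and the word at the fixed time \<open>n\<close> differ by a factor spelled by
  the letters between the two times; describing that factor costs, by Wald's identity, an amount
  proportional to the mean distance of the two times.\<close>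

lemma entropy_stopping_coupling:
  fixes \<mu> :: "'a pmf" and W :: "'a list pmf" and n :: nat
  assumes mu: "set_pmf \<mu> \<subseteq> carrier G" and W: "stopping_law \<mu> W"
    and sW: "\<And>w. w \<in> set_pmf W \<Longrightarrow> set w \<subseteq> carrier G"
  defines "cost \<equiv> ennreal (2 * ln 2) + (ennreal (ln 2) + entropy_pmf \<mu>)
      * (\<integral>\<^sup>+w. of_nat (length w - n + (n - length w)) \<partial>W)"
  shows "entropy_pmf (map_pmf word_prod W) \<le> entropy_pmf (walk_pmf \<mu> n) + cost"
    and "entropy_pmf (walk_pmf \<mu> n) \<le> entropy_pmf (map_pmf word_prod W) + cost"
proof -
  \<comment> \<open>The coupling consists of the stopped word and just enough fresh letters to reach
    length \<open>n\<close>. If the stopped word is already that long, there are none.\<close>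
  define J where "J = bind_pmf W (\<lambda>w. map_pmf (Pair w) (replicate_pmf (n - length w) \<mu>))"
  \<comment> \<open>The letters read between the two times, with the flag \<open>True\<close> when
    the stopping time does not exceed \<open>n\<close>.\<close>
  define btw :: "'a list \<times> 'a list \<Rightarrow> bool \<times> 'a list" where
    "btw = (\<lambda>(w, v). (length w \<le> n, if length w \<le> n then v else drop n w))"
  define Z1 :: "'a list \<times> 'a list \<Rightarrow> 'a" where "Z1 = (\<lambda>(w, v). word_prod w)"
  define Z2 :: "'a list \<times> 'a list \<Rightarrow> 'a" where "Z2 = (\<lambda>(w, v). word_prod (take n (w @ v)))"
  have J: "w \<in> set_pmf W \<and> set v \<subseteq> carrier G \<and> length v = n - length w" if "(w, v) \<in> set_pmf J" for w v
    using that mu by (auto simp: J_def set_replicate_pmf)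
  have Z1: "map_pmf Z1 J = map_pmf word_prod W"
    by (simp add: J_def Z1_def map_bind_pmf pmf.map_comp comp_def) (simp add: map_pmf_def)
  have "map_pmf Z2 J = map_pmf word_prod
      (bind_pmf W (\<lambda>w. map_pmf (\<lambda>v. take n (w @ v)) (replicate_pmf (n - length w) \<mu>)))"
    by (simp add: J_def Z2_def map_bind_pmf pmf.map_comp comp_def del: take_append)
  then have Z2: "map_pmf Z2 J = walk_pmf \<mu> n"
    by (simp add: stopping_lawD_take[OF W] walk_pmf_def del: take_append)
  \<comment> \<open>Each position is recovered from the other one and \<open>btw\<close>. The flag
    is needed because it decides whether to multiply by the factor or by its inverse.\<close>
  have rel: "Z2 x = (if fst (btw x) then Z1 x \<otimes> word_prod (snd (btw x)) else Z1 x \<otimes> inv (word_prod (snd (btw x))))"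
       "Z1 x = (if fst (btw x) then Z2 x \<otimes> inv (word_prod (snd (btw x))) else Z2 x \<otimes> word_prod (snd (btw x)))"
    if "x \<in> set_pmf J" for x
  proof -
    obtain w v where x: "x = (w, v)" by (cases x)
    from J[of w v] that sW have wv: "set w \<subseteq> carrier G" "set v \<subseteq> carrier G" "length v = n - length w"
      unfolding x by auto
    have dt: "set (take n w) \<subseteq> carrier G" "set (drop n w) \<subseteq> carrier G"
      using wv(1) set_take_subset[of n w] set_drop_subset[of n w] by auto
    have c: "word_prod w \<in> carrier G" "word_prod v \<in> carrier G"
        "word_prod (take n w) \<in> carrier G" "word_prod (drop n w) \<in> carrier G"
      using wv dt by simp_all
    have split: "word_prod w = word_prod (take n w) \<otimes> word_prod (drop n w)"
      using word_prod_append[OF dt] by simp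
    have "Z2 x = (if fst (btw x) then Z1 x \<otimes> word_prod (snd (btw x)) else Z1 x \<otimes> inv (word_prod (snd (btw x)))) \<and>
       Z1 x = (if fst (btw x) then Z2 x \<otimes> inv (word_prod (snd (btw x))) else Z2 x \<otimes> word_prod (snd (btw x)))"
    proof (cases "length w \<le> n")
      case True
      then have "take n (w @ v) = w @ v" using wv(3) by simp
      then have "Z2 x = word_prod w \<otimes> word_prod v" "Z1 x = word_prod w" "btw x = (True, v)"
        using True wv by (simp_all add: x Z1_def Z2_def btw_def word_prod_append del: take_append)
      then show ?thesis using c by (simp add: m_assoc)
    next
      case False
      then have "take n (w @ v) = take n w" by simp
      then have "Z2 x = word_prod (take n w)" "Z1 x = word_prod (take n w) \<otimes> word_prod (drop n w)"
          "btw x = (False, drop n w)"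
        using False split by (simp_all add: x Z1_def Z2_def btw_def del: take_append)
      then show ?thesis using c by (simp add: m_assoc)
    qed
    then show "Z2 x = (if fst (btw x) then Z1 x \<otimes> word_prod (snd (btw x)) else Z1 x \<otimes> inv (word_prod (snd (btw x))))"
       "Z1 x = (if fst (btw x) then Z2 x \<otimes> inv (word_prod (snd (btw x))) else Z2 x \<otimes> word_prod (snd (btw x)))"
      by blast+
  qed
  have bound: "(\<integral>\<^sup>+x. neg_ln (pmf (word_code \<mu>) (btw x)) \<partial>J) \<le> cost"
  proof -
    let ?f = "\<lambda>a. ennreal (ln 2) + neg_ln (pmf \<mu> a)"
    \<comment> \<open>The length part of the code is distributed over the letters. What remains is a
      fixed overhead plus a sum over letters, the shape to which Wald's identity applies.\<close>
    have len: "ennreal (ln 2 * (real (length u) + 2)) + (\<Sum>x\<leftarrow>u. neg_ln (pmf \<mu> x))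
        = ennreal (2 * ln 2) + (\<Sum>x\<leftarrow>u. ?f x)" for u
    proof -
      have "ennreal (ln 2 * (real (length u) + 2)) = ennreal (2 * ln 2) + of_nat (length u) * ennreal (ln 2)"
        by (simp add: ennreal_of_nat_eq_real_of_nat ennreal_mult'[symmetric] ennreal_plus[symmetric] algebra_simps
              del: ennreal_plus)
      then show ?thesis by (simp add: sum_list_addf sum_list_triv add.assoc)
    qed
    have "(\<integral>\<^sup>+x. neg_ln (pmf (word_code \<mu>) (btw x)) \<partial>J)
        \<le> (\<integral>\<^sup>+x. ennreal (2 * ln 2) + (\<Sum>a\<leftarrow>snd (btw x). ?f a) \<partial>J)"
      unfolding len[symmetric]
      by (intro nn_integral_mono) (metis neg_ln_word_code_le prod.collapse)
    also have "\<dots> = ennreal (2 * ln 2) + (\<integral>\<^sup>+x. (\<Sum>a\<leftarrow>snd (btw x). ?f a) \<partial>J)"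
      by (simp add: nn_integral_add)
    \<comment> \<open>One formula covers both cases: \<open>drop n w\<close> is empty when the
      stopped word is short, and \<open>n - length w\<close> is 0 when it is long.\<close>
    also have "(\<integral>\<^sup>+x. (\<Sum>a\<leftarrow>snd (btw x). ?f a) \<partial>J)
        = (\<integral>\<^sup>+w. (\<Sum>a\<leftarrow>drop n w. ?f a) + of_nat (n - length w) * (\<integral>\<^sup>+a. ?f a \<partial>\<mu>) \<partial>W)"
      unfolding J_def nn_integral_bind_pmf nn_integral_map_pmf
    proof (intro nn_integral_cong)
      fix w :: "'a list"
      have v: "(\<integral>\<^sup>+v. sum_list (map ?f v) \<partial>replicate_pmf (n - length w) \<mu>)
          = of_nat (n - length w) * (\<integral>\<^sup>+a. ?f a \<partial>\<mu>)"
        by (rule wald_replicate)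
      show "(\<integral>\<^sup>+v. (\<Sum>a\<leftarrow>snd (btw (w, v)). ?f a) \<partial>replicate_pmf (n - length w) \<mu>)
          = (\<Sum>a\<leftarrow>drop n w. ?f a) + of_nat (n - length w) * (\<integral>\<^sup>+a. ?f a \<partial>\<mu>)"
      proof (cases "length w \<le> n")
        case True
        then have "snd (btw (w, v)) = v" "drop n w = []" for v by (simp_all add: btw_def)
        then show ?thesis using v by simp
      next
        case False
        then have "snd (btw (w, v)) = drop n w" for v by (simp add: btw_def)
        then show ?thesis using False by simp
      qed
    qed
    also have "\<dots> = (\<integral>\<^sup>+a. ?f a \<partial>\<mu>) * (\<integral>\<^sup>+w. of_nat (length w - n + (n - length w)) \<partial>W)"
    proof -
      define A where "A = (\<integral>\<^sup>+a. ?f a \<partial>\<mu>)"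
      have "(\<integral>\<^sup>+w. (\<Sum>a\<leftarrow>drop n w. ?f a) + of_nat (n - length w) * A \<partial>W)
          = (\<integral>\<^sup>+w. (\<Sum>a\<leftarrow>drop n w. ?f a) \<partial>W) + (\<integral>\<^sup>+w. of_nat (n - length w) * A \<partial>W)"
        by (rule nn_integral_add) auto
      also have "\<dots> = (\<integral>\<^sup>+w. of_nat (length w - n) \<partial>W) * A + (\<integral>\<^sup>+w. of_nat (n - length w) \<partial>W) * A"
        unfolding wald_drop[OF W] A_def by (subst nn_integral_multc) auto
      also have "\<dots> = A * (\<integral>\<^sup>+w. of_nat (length w - n) + of_nat (n - length w) \<partial>W)"
        by (subst nn_integral_add) (auto simp: distrib_left mult.commute)
      finally show ?thesis by (simp add: A_def)
    qed
    also have "(\<integral>\<^sup>+a. ?f a \<partial>\<mu>) = ennreal (ln 2) + entropy_pmf \<mu>"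
      by (simp add: nn_integral_add entropy_pmf_def)
    finally show ?thesis by (simp add: cost_def)
  qed
  \<comment> \<open>Used in both directions; only the decoding map \<open>phi\<close> changes, by
    exchanging the roles of the factor and its inverse.\<close>
  have transfer: "entropy_pmf (map_pmf Y J) \<le> entropy_pmf (map_pmf X J) + cost"
    if phi: "\<And>x. x \<in> set_pmf J \<Longrightarrow> Y x = phi (X x, btw x)" for X Y :: "'a list \<times> 'a list \<Rightarrow> 'a" and phi
  proof -
    let ?K = "map_pmf (\<lambda>x. (X x, btw x)) J"
    have "map_pmf Y J = map_pmf phi ?K"
      unfolding pmf.map_comp by (intro map_pmf_cong refl) (simp add: phi)
    moreover have "map_pmf fst ?K = map_pmf X J"
      by (simp add: pmf.map_comp comp_def)
    ultimately show ?thesis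
      using entropy_map_coupling_le[of phi ?K "word_code \<mu>"] bound
      by (auto intro: order_trans add_left_mono)
  qed
  show "entropy_pmf (map_pmf word_prod W) \<le> entropy_pmf (walk_pmf \<mu> n) + cost"
    unfolding Z1[symmetric] Z2[symmetric]
    by (rule transfer[where phi = "\<lambda>(z, b, u). if b then z \<otimes> inv (word_prod u) else z \<otimes> word_prod u"])
       (simp add: rel(2) split_beta)
  show "entropy_pmf (walk_pmf \<mu> n) \<le> entropy_pmf (map_pmf word_prod W) + cost"
    unfolding Z1[symmetric] Z2[symmetric]
    by (rule transfer[where phi = "\<lambda>(z, b, u). if b then z \<otimes> word_prod u else z \<otimes> inv (word_prod u)"])
       (simp add: rel(1) split_beta)
qed

end

section \<open>Identification of the hitting measure with the law of the first return word\<close>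

lemma pmf_bind_map_Cons:
  "pmf (bind_pmf p (\<lambda>a. map_pmf ((#) a) (F a))) (x # u) = pmf p x * pmf (F x) u"
proof -
  have "pmf (map_pmf ((#) a) (F a)) (x # u) = pmf (F x) u * indicator {x} a" for a
  proof (cases "a = x")
    case True
    then show ?thesis by (simp add: pmf_map_inj')
  next
    case False
    then have "(#) a -` {x # u} = {}" by auto
    then show ?thesis using False by (simp add: pmf_map)
  qed
  then have "ennreal (pmf (bind_pmf p (\<lambda>a. map_pmf ((#) a) (F a))) (x # u))
      = (\<integral>\<^sup>+a. ennreal (pmf (F x) u) * indicator {x} a \<partial>p)"
    unfolding ennreal_pmf_bind by (intro nn_integral_cong) (simp add: indicator_def)
  also have "\<dots> = ennreal (pmf p x * pmf (F x) u)"
    by (subst nn_integral_cmult_indicator) (auto simp: emeasure_pmf_single ennreal_mult'[symmetric] mult.commute)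
  finally show ?thesis by simp
qed

context bijective_walk
begin

fun first_hit :: "'s \<Rightarrow> 'a list \<Rightarrow> bool" where
  "first_hit c [] = False"
| "first_hit c (a # u) = (if step c a = orig then u = [] else first_hit (step c a) u)"

lemma first_hit_iff:
  "first_hit c w \<longleftrightarrow> w \<noteq> [] \<and> foldl step c w = orig \<and>
     (\<forall>j. 0 < j \<longrightarrow> j < length w \<longrightarrow> foldl step c (take j w) \<noteq> orig)"
proof (induction w arbitrary: c)
  case (Cons a u)
  have split: "(\<forall>j. 0 < j \<longrightarrow> j < length (a # u) \<longrightarrow> foldl step c (take j (a # u)) \<noteq> orig)
      \<longleftrightarrow> (\<forall>j<length u. foldl step (step c a) (take j u) \<noteq> orig)"
  proof -
    have "(\<forall>j. 0 < j \<longrightarrow> P j) \<longleftrightarrow> (\<forall>j. P (Suc j))" for P :: "nat \<Rightarrow> bool"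
      by (metis gr0_conv_Suc zero_less_Suc)
    then show ?thesis by simp
  qed
  show ?case
  proof (cases "u = []")
    case False
    \<comment> \<open>The shifted range starts at index 0, where the state is
      \<open>step c a\<close>; this is the case tested by the recursion.\<close>
    have "(\<forall>j<length u. foldl step (step c a) (take j u) \<noteq> orig)
      \<longleftrightarrow> step c a \<noteq> orig \<and> (\<forall>j. 0 < j \<longrightarrow> j < length u \<longrightarrow> foldl step (step c a) (take j u) \<noteq> orig)"
      using False by (metis foldl_Nil gr0I length_greater_0_conv take0)
    then show ?thesis unfolding split using False Cons.IH[of "step c a"] by auto
  qed simp
qed simp

text \<open>Every letter is weighted by its mass and reading stops exactly at the first hit. This
  closed form can be matched with cylinders of the increment space.\<close>

lemma pmf_hit:
  "c \<in> S \<Longrightarrow> pmf (hit c) w = (if first_hit c w then (\<Prod>a\<leftarrow>w. pmf \<mu> a) else 0)"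
proof (induction w arbitrary: c)
  case Nil
  have "[] \<notin> set_pmf (hit c)" unfolding hit_unfold[OF Nil] by (auto split: if_splits)
  then show ?case by (simp add: set_pmf_iff)
next
  case (Cons a u)
  have "hit c = bind_pmf \<mu> (\<lambda>a. map_pmf ((#) a) (if step c a = orig then return_pmf [] else hit (step c a)))"
    unfolding hit_unfold[OF Cons.prems] by (intro bind_pmf_cong refl) simp
  then have eq: "pmf (hit c) (a # u)
      = pmf \<mu> a * pmf (if step c a = orig then return_pmf [] else hit (step c a)) u"
    by (simp only: pmf_bind_map_Cons)
  show ?case
  proof (cases "a \<in> set_pmf \<mu>")
    case True
    then show ?thesis unfolding eq
      using Cons.IH[OF step_S[OF Cons.prems True]] by (auto simp: pmf_return)
  next
    case False
    then show ?thesis unfolding eq by (simp add: set_pmf_iff)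
  qed
qed

lemma set_hit: "c \<in> S \<Longrightarrow> w \<in> set_pmf (hit c) \<Longrightarrow> set w \<subseteq> set_pmf \<mu>"
  by (auto simp: set_pmf_iff pmf_hit prod_list_zero_iff split: if_splits)

lemma set_blocks: "w \<in> set_pmf (blocks k) \<Longrightarrow> set w \<subseteq> set_pmf \<mu>"
  by (induction k arbitrary: w) (use set_hit[OF orig_S] in fastforce)+

end

context group
begin

lemma foldl_rcoset:
  "C \<subseteq> carrier G \<Longrightarrow> set u \<subseteq> carrier G \<Longrightarrow> foldl (#>) C u = C #> word_prod u"
  by (induction u arbitrary: C) (auto simp: coset_mult_assoc r_coset_subset_G)

text \<open>Increments are multiplied on the right, so it is the right coset of the position that
  evolves as a walk, and right multiplication by \<open>inv a\<close> undoes the letter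
  \<open>a\<close>. Every element is a product of support letters without inverses, so each coset is
  reached by an admissible word.\<close>

lemma rcosets_bijective_walk:
  assumes mu: "set_pmf \<mu> \<subseteq> carrier G" and gen: "semigroup_generated G (set_pmf \<mu>) = carrier G"
    and H: "subgroup \<Gamma> G" and fin: "finite (rcosets \<Gamma>)"
  shows "bijective_walk \<mu> (rcosets \<Gamma>) (#>) \<Gamma>"
proof
  have sub: "C \<subseteq> carrier G" if "C \<in> rcosets \<Gamma>" for C
    using that r_coset_subset_G[OF subgroup.subset[OF H]] by (auto simp: RCOSETS_def)
  have cl: "C #> a \<in> rcosets \<Gamma>" if C: "C \<in> rcosets \<Gamma>" and a: "a \<in> carrier G" for C a
  proof -
    obtain x where x: "x \<in> carrier G" "C = \<Gamma> #> x" using C by (auto simp: RCOSETS_def)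
    then have "C #> a = \<Gamma> #> (x \<otimes> a)"
      using a coset_mult_assoc[OF subgroup.subset[OF H] x(1) a] by simp
    then show ?thesis using x a rcosetsI[OF subgroup.subset[OF H]] by simp
  qed
  show "finite (rcosets \<Gamma>)" by (rule fin)
  show "\<Gamma> \<in> rcosets \<Gamma>" by (rule subgroup.subgroup_in_rcosets[OF H group_axioms])
  show "bij_betw (\<lambda>c. c #> a) (rcosets \<Gamma>) (rcosets \<Gamma>)" if "a \<in> set_pmf \<mu>" for a
  proof -
    have a: "a \<in> carrier G" using that mu by auto
    show ?thesis
      by (rule bij_betw_byWitness[where f' = "\<lambda>c. c #> inv a"])
         (use a sub cl in \<open>auto simp: coset_mult_assoc\<close>)
  qed
  have word: "\<exists>u\<in>lists (set_pmf \<mu>). x = word_prod u" if "x \<in> semigroup_generated G (set_pmf \<mu>)" for x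
    using that
  proof induction
    case (incl s)
    then show ?case using mu by (intro bexI[of _ "[s]"]) auto
  next
    case (mult x y)
    then obtain u v where "u \<in> lists (set_pmf \<mu>)" "v \<in> lists (set_pmf \<mu>)" "x = word_prod u" "y = word_prod v"
      by blast
    then show ?case using mu
      by (intro bexI[of _ "u @ v"]) (auto simp: word_prod_append subset_iff)
  qed
  show "\<exists>u\<in>lists (set_pmf \<mu>). foldl (#>) \<Gamma> u = C" if C: "C \<in> rcosets \<Gamma>" for C
  proof -
    obtain x where x: "x \<in> carrier G" "C = \<Gamma> #> x" using C by (auto simp: RCOSETS_def)
    then obtain u where u: "u \<in> lists (set_pmf \<mu>)" "x = word_prod u" using word gen by blast
    then have "foldl (#>) \<Gamma> u = C"
      using foldl_rcoset[OF subgroup.subset[OF H], of u] mu x by auto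
    then show ?thesis using u by blast
  qed
qed

lemma random_walk_eq_word_prod:
  "(\<And>i. x i \<in> carrier G) \<Longrightarrow> random_walk G x n = word_prod (map x [0..<n])"
proof (induction n)
  case (Suc n)
  have "word_prod (map x [0..<Suc n]) = word_prod (map x [0..<n] @ [x n])" by simp
  also have "\<dots> = random_walk G x n \<otimes> x n"
    using Suc by (subst word_prod_append) auto
  finally show ?case by simp
qed simp

lemma emeasure_increment_space_cylinder:
  assumes mu: "set_pmf \<mu> \<subseteq> carrier G" and w: "set w \<subseteq> carrier G"
  shows "{x \<in> space (increment_space G \<mu>). map x [0..<length w] = w} \<in> sets (increment_space G \<mu>)"
    and "emeasure (increment_space G \<mu>) {x \<in> space (increment_space G \<mu>). map x [0..<length w] = w}
      = ennreal (\<Prod>a\<leftarrow>w. pmf \<mu> a)"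
proof -
  let ?M = "restrict_space (measure_pmf \<mu>) (carrier G)"
  have one: "emeasure (measure_pmf \<mu>) (carrier G) = 1"
    using mu by (intro measure_pmf.emeasure_eq_1_AE) (auto intro!: AE_pmfI)
  interpret M: prob_space ?M
    by (intro prob_space_restrict_space one) simp
  interpret product_prob_space "\<lambda>_. ?M" "UNIV :: nat set"
    by unfold_locales
  let ?J = "{..<length w}"
  let ?X = "\<lambda>j. {w ! j}"
  have X: "?X j \<in> sets ?M" if "j \<in> ?J" for j
  proof -
    have "w ! j \<in> carrier G" using that w nth_mem[of j w] by auto
    then show ?thesis by (subst sets_restrict_space_iff) auto
  qed
  have eq: "{x \<in> space (increment_space G \<mu>). map x [0..<length w] = w}
      = prod_emb UNIV (\<lambda>_. ?M) ?J (\<Pi>\<^sub>E j\<in>?J. ?X j)"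
  proof (rule Set.set_eqI)
    fix x :: "nat \<Rightarrow> 'a"
    have "x \<in> space (increment_space G \<mu>) \<longleftrightarrow> (\<forall>i. x i \<in> carrier G)"
      by (simp add: increment_space_def space_PiM space_restrict_space PiE_UNIV_domain Pi_iff)
    moreover have "map x [0..<length w] = w \<longleftrightarrow> (\<forall>j<length w. x j = w ! j)"
      by (subst list_eq_iff_nth_eq) simp
    moreover have "x \<in> prod_emb UNIV (\<lambda>_. ?M) ?J (\<Pi>\<^sub>E j\<in>?J. ?X j)
        \<longleftrightarrow> (\<forall>i. x i \<in> carrier G) \<and> (\<forall>j<length w. x j = w ! j)"
      by (auto simp: prod_emb_iff restrict_PiE_iff space_restrict_space)
    ultimately show "x \<in> {x \<in> space (increment_space G \<mu>). map x [0..<length w] = w}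
      \<longleftrightarrow> x \<in> prod_emb UNIV (\<lambda>_. ?M) ?J (\<Pi>\<^sub>E j\<in>?J. ?X j)" by simp
  qed
  show "{x \<in> space (increment_space G \<mu>). map x [0..<length w] = w} \<in> sets (increment_space G \<mu>)"
    unfolding eq unfolding increment_space_def by (intro sets_PiM_I) (use X in auto)
  have "emeasure (increment_space G \<mu>) {x \<in> space (increment_space G \<mu>). map x [0..<length w] = w}
      = (\<Prod>j\<in>?J. emeasure ?M (?X j))"
    unfolding eq unfolding increment_space_def by (intro emeasure_PiM_emb) (use X in auto)
  also have "\<dots> = (\<Prod>j\<in>?J. ennreal (pmf \<mu> (w ! j)))"
  proof (intro prod.cong refl)
    fix j assume "j \<in> ?J"
    then have "w ! j \<in> carrier G" using w nth_mem[of j w] by auto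
    then show "emeasure ?M (?X j) = ennreal (pmf \<mu> (w ! j))"
      by (simp add: emeasure_restrict_space emeasure_pmf_single)
  qed
  also have "\<dots> = ennreal (\<Prod>a\<leftarrow>w. pmf \<mu> a)"
    by (simp add: prod_ennreal prod.list_conv_set_nth atLeast0LessThan)
  finally show "emeasure (increment_space G \<mu>) {x \<in> space (increment_space G \<mu>). map x [0..<length w] = w}
      = ennreal (\<Prod>a\<leftarrow>w. pmf \<mu> a)" .
qed

text \<open>The event splits into cylinders, one for each word that first returns at its last letter
  and has product \<open>\<gamma>\<close>. There are countably many words over the carrier, so the
  masses add up to the mass of these words under \<open>hit\<close>.\<close>

lemma hitting_measure_eq_pmf:
  assumes G: "countable (carrier G)" and mu: "set_pmf \<mu> \<subseteq> carrier G"
    and H: "subgroup \<Gamma> G" and walk: "bijective_walk \<mu> (rcosets \<Gamma>) (#>) \<Gamma>"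
  shows "hitting_measure G \<mu> \<Gamma> \<gamma> = pmf (map_pmf word_prod (bijective_walk.hit \<mu> (#>) \<Gamma> \<Gamma>)) \<gamma>"
proof -
  interpret bijective_walk \<mu> "rcosets \<Gamma>" "(#>)" \<Gamma> by (rule walk)
  let ?P = "increment_space G \<mu>"
  let ?cyl = "\<lambda>w. {x \<in> space ?P. map x [0..<length w] = w}"
  define I where "I = {w \<in> lists (carrier G). first_hit \<Gamma> w \<and> word_prod w = \<gamma>}"
  have in_carrier: "x i \<in> carrier G" if "x \<in> space ?P" for x i
    using that by (auto simp: increment_space_def space_PiM space_restrict_space)
  have fh: "first_hit \<Gamma> w \<longleftrightarrow> w \<noteq> [] \<and> word_prod w \<in> \<Gamma> \<and>
      (\<forall>j. 0 < j \<longrightarrow> j < length w \<longrightarrow> word_prod (take j w) \<notin> \<Gamma>)" if w: "set w \<subseteq> carrier G" for w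
  proof -
    have iff: "foldl (#>) \<Gamma> u = \<Gamma> \<longleftrightarrow> word_prod u \<in> \<Gamma>" if u: "set u \<subseteq> carrier G" for u
      unfolding foldl_rcoset[OF subgroup.subset[OF H] u]
      using coset_join1[OF _ word_prod_closed[OF u] H] coset_join2[OF word_prod_closed[OF u] H] by blast
    have "set (take j w) \<subseteq> carrier G" for j using w set_take_subset[of j w] by blast
    then show ?thesis unfolding first_hit_iff using iff w by simp
  qed
  \<comment> \<open>This also makes the cylinders disjoint: a path determines the length of its
    return word, and hence the word.\<close>
  have cyl_iff: "first_hit \<Gamma> (map x [0..<n]) \<longleftrightarrow> (\<exists>n\<ge>1. random_walk G x n \<in> \<Gamma>) \<and> n = return_time G \<Gamma> x"
    if x: "x \<in> space ?P" for x n
  proof -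
    have rw: "random_walk G x j = word_prod (map x [0..<j])" for j
      by (rule random_walk_eq_word_prod) (rule in_carrier[OF x])
    have "first_hit \<Gamma> (map x [0..<n]) \<longleftrightarrow> 1 \<le> n \<and> random_walk G x n \<in> \<Gamma> \<and>
        (\<forall>j. 1 \<le> j \<longrightarrow> j < n \<longrightarrow> random_walk G x j \<notin> \<Gamma>)"
      by (subst fh) (auto simp: in_carrier[OF x] rw take_map Suc_le_eq min_def)
    also have "\<dots> \<longleftrightarrow> (\<exists>n\<ge>1. random_walk G x n \<in> \<Gamma>) \<and> n = return_time G \<Gamma> x"
    proof
      assume *: "1 \<le> n \<and> random_walk G x n \<in> \<Gamma> \<and> (\<forall>j. 1 \<le> j \<longrightarrow> j < n \<longrightarrow> random_walk G x j \<notin> \<Gamma>)"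
      then have "return_time G \<Gamma> x = n"
        unfolding return_time_def by (intro Least_equality) (auto simp: not_less[symmetric])
      then show "(\<exists>n\<ge>1. random_walk G x n \<in> \<Gamma>) \<and> n = return_time G \<Gamma> x" using * by blast
    next
      assume *: "(\<exists>n\<ge>1. random_walk G x n \<in> \<Gamma>) \<and> n = return_time G \<Gamma> x"
      then have "1 \<le> n \<and> random_walk G x n \<in> \<Gamma>"
        unfolding return_time_def by (metis (mono_tags, lifting) LeastI)
      moreover have "random_walk G x j \<notin> \<Gamma>" if "1 \<le> j" "j < n" for j
        using * that not_less_Least unfolding return_time_def by blast
      ultimately show "1 \<le> n \<and> random_walk G x n \<in> \<Gamma> \<and> (\<forall>j. 1 \<le> j \<longrightarrow> j < n \<longrightarrow> random_walk G x j \<notin> \<Gamma>)"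
        by blast
    qed
    finally show ?thesis .
  qed
  have event: "{x \<in> space ?P. (\<exists>n\<ge>1. random_walk G x n \<in> \<Gamma>) \<and> random_walk G x (return_time G \<Gamma> x) = \<gamma>}
      = (\<Union>w\<in>I. ?cyl w)"
  proof (intro equalityI subsetI)
    fix x assume x: "x \<in> {x \<in> space ?P. (\<exists>n\<ge>1. random_walk G x n \<in> \<Gamma>) \<and> random_walk G x (return_time G \<Gamma> x) = \<gamma>}"
    let ?w = "map x [0..<return_time G \<Gamma> x]"
    have "?w \<in> I" "x \<in> ?cyl ?w"
      using x cyl_iff[of x "return_time G \<Gamma> x"] in_carrier[of x]
      by (auto simp: I_def random_walk_eq_word_prod)
    then show "x \<in> (\<Union>w\<in>I. ?cyl w)" by blast
  next
    fix x assume "x \<in> (\<Union>w\<in>I. ?cyl w)"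
    then obtain w where w: "w \<in> I" "x \<in> space ?P" "map x [0..<length w] = w" by blast
    then show "x \<in> {x \<in> space ?P. (\<exists>n\<ge>1. random_walk G x n \<in> \<Gamma>) \<and> random_walk G x (return_time G \<Gamma> x) = \<gamma>}"
      using cyl_iff[of x "length w"] in_carrier[of x]
      by (auto simp: I_def random_walk_eq_word_prod)
  qed
  have disj: "disjoint_family_on ?cyl I"
  proof (unfold disjoint_family_on_def, intro ballI impI)
    fix w w' assume w: "w \<in> I" "w' \<in> I" "w \<noteq> w'"
    have "w = w'" if "x \<in> ?cyl w" "x \<in> ?cyl w'" for x
      using that w cyl_iff[of x "length w"] cyl_iff[of x "length w'"] by (auto simp: I_def)
    then show "?cyl w \<inter> ?cyl w' = {}" using w by blast
  qed
  have cI: "countable I" unfolding I_def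
    by (rule countable_subset[OF _ countable_lists[OF G]]) auto
  have "emeasure ?P (\<Union>w\<in>I. ?cyl w) = (\<integral>\<^sup>+w. emeasure ?P (?cyl w) \<partial>count_space I)"
    by (rule emeasure_UN_countable[OF _ cI disj])
       (auto simp: I_def intro!: emeasure_increment_space_cylinder[OF mu])
  also have "\<dots> = (\<integral>\<^sup>+w. ennreal (pmf (hit \<Gamma>) w) \<partial>count_space I)"
  proof (intro nn_integral_cong)
    fix w assume "w \<in> space (count_space I)"
    then have "set w \<subseteq> carrier G" "first_hit \<Gamma> w" by (auto simp: I_def)
    then show "emeasure ?P (?cyl w) = ennreal (pmf (hit \<Gamma>) w)"
      by (simp add: emeasure_increment_space_cylinder(2)[OF mu] pmf_hit[OF orig_S])
  qed
  also have "\<dots> = emeasure (measure_pmf (hit \<Gamma>)) I" by (rule nn_integral_pmf)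
  finally have "hitting_measure G \<mu> \<Gamma> \<gamma> = measure (measure_pmf (hit \<Gamma>)) I"
    unfolding hitting_measure_def event measure_def by simp
  \<comment> \<open>Words with product \<open>\<gamma>\<close> outside \<open>I\<close> are not
    first returns or leave the carrier, and such words have mass 0.\<close>
  also have "\<dots> = measure (measure_pmf (hit \<Gamma>)) (word_prod -` {\<gamma>})"
  proof (intro measure_prob_cong_0)
    fix w assume w: "w \<in> word_prod -` {\<gamma>} - I"
    have "w \<in> I" if "pmf (hit \<Gamma>) w \<noteq> 0"
    proof -
      have "first_hit \<Gamma> w" using that by (simp add: pmf_hit[OF orig_S] split: if_splits)
      moreover have "set w \<subseteq> carrier G" using set_hit[OF orig_S, of w] that mu by (auto simp: set_pmf_iff)
      ultimately show ?thesis using w by (auto simp: I_def)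
    qed
    then show "pmf (hit \<Gamma>) w = 0" using w by blast
  qed (auto simp: I_def)
  finally show ?thesis by (simp add: pmf_map)
qed

end

section \<open>Convolution powers of the hitting measure and the conclusion\<close>

text \<open>The product of a concatenation is the product of the block products, and the blocks are
  independent. Hence the k-th convolution power is the law of the position at the k-th
  return.\<close>

lemma (in group) walk_pmf_hit:
  assumes mu: "set_pmf \<mu> \<subseteq> carrier G" and walk: "bijective_walk \<mu> S step orig"
  shows "walk_pmf (map_pmf word_prod (bijective_walk.hit \<mu> step orig orig)) k
    = map_pmf word_prod (bijective_walk.blocks \<mu> step orig k)"
proof -
  interpret bijective_walk \<mu> S step orig by (rule walk)
  let ?\<theta> = "map_pmf word_prod (hit orig)"
  have hit: "set w \<subseteq> carrier G" if "w \<in> set_pmf (hit orig)" for w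
    using set_hit[OF orig_S that] mu by blast
  have blocks: "set w \<subseteq> carrier G" if "w \<in> set_pmf (blocks k)" for w k
    using set_blocks[OF that] mu by blast
  have theta: "set_pmf ?\<theta> \<subseteq> carrier G" using hit by auto
  show ?thesis
  proof (induction k)
    case (Suc k)
    have "walk_pmf ?\<theta> (1 + k) = bind_pmf ?\<theta> (\<lambda>x. map_pmf ((\<otimes>) x) (map_pmf word_prod (blocks k)))"
      by (simp only: walk_pmf_add[OF theta] walk_pmf_1[OF theta] Suc)
    also have "\<dots> = bind_pmf (hit orig) (\<lambda>w. map_pmf (\<lambda>v. word_prod (w @ v)) (blocks k))"
      unfolding bind_map_pmf pmf.map_comp comp_def
      by (intro bind_pmf_cong map_pmf_cong refl) (simp add: word_prod_append hit blocks)
    also have "\<dots> = map_pmf word_prod (blocks (Suc k))"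
      by (simp add: map_bind_pmf pmf.map_comp comp_def)
    finally show ?case by simp
  qed (simp add: walk_pmf_def)
qed

theorem corollary1p3:
  fixes G :: "('a, 'b) monoid_scheme" and \<mu> :: "'a pmf" and \<Gamma> :: "'a set"
  assumes "group G" and "countable (carrier G)"
    and "set_pmf \<mu> \<subseteq> carrier G"
    and "semigroup_generated G (set_pmf \<mu>) = carrier G"
    and "entropy_on G (pmf \<mu>) < \<infinity>"
    and "subgroup \<Gamma> G" and "finite (rcosets\<^bsub>G\<^esub> \<Gamma>)"
  shows "random_walk_entropy (G\<lparr>carrier := \<Gamma>\<rparr>) (hitting_measure G \<mu> \<Gamma>)
           = of_nat (card (rcosets\<^bsub>G\<^esub> \<Gamma>)) * random_walk_entropy G (pmf \<mu>)"
proof -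
  note mu = assms(3)
  interpret group G by (rule assms(1))
  let ?H = "G\<lparr>carrier := \<Gamma>\<rparr>"
  let ?S = "rcosets\<^bsub>G\<^esub> \<Gamma>"
  let ?d = "card ?S"
  interpret H: group ?H by (rule subgroup.subgroup_is_group[OF assms(6,1)])
  interpret W: bijective_walk \<mu> ?S "(#>\<^bsub>G\<^esub>)" \<Gamma>
    by (rule rcosets_bijective_walk[OF mu assms(4,6,7)])
  define \<theta> where "\<theta> = map_pmf word_prod (W.hit \<Gamma>)"
  \<comment> \<open>A return word brings the coset \<open>\<Gamma>\<close> back to itself, so its
    product lies in \<open>\<Gamma>\<close>.\<close>
  have theta: "set_pmf \<theta> \<subseteq> \<Gamma>"
  proof
    fix g assume "g \<in> set_pmf \<theta>"
    then obtain w where w: "w \<in> set_pmf (W.hit \<Gamma>)" "g = word_prod w" by (auto simp: \<theta>_def)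
    then have "W.first_hit \<Gamma> w" by (auto simp: set_pmf_iff W.pmf_hit[OF W.orig_S] split: if_splits)
    then have "foldl (#>\<^bsub>G\<^esub>) \<Gamma> w = \<Gamma>" by (simp add: W.first_hit_iff)
    moreover have sw: "set w \<subseteq> carrier G" using W.set_hit[OF W.orig_S w(1)] mu by blast
    ultimately have "\<Gamma> #>\<^bsub>G\<^esub> g = \<Gamma>"
      using foldl_rcoset[OF subgroup.subset[OF assms(6)] sw] w(2) by simp
    then show "g \<in> \<Gamma>" by (rule coset_join1) (use w(2) sw assms(6) in auto)
  qed
  have walk_H: "H.walk_pmf \<theta> k = map_pmf word_prod (W.blocks k)" for k
  proof -
    \<comment> \<open>The subgroup inherits multiplication and unit, so products of words do not
      depend on which of the two groups is meant.\<close>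
    have "H.word_prod = word_prod"
      by (simp add: fun_eq_iff H.word_prod_def word_prod_def)
    then have "H.walk_pmf \<theta> k = walk_pmf \<theta> k"
      by (simp add: H.walk_pmf_def walk_pmf_def)
    then show ?thesis
      unfolding \<theta>_def by (simp only: walk_pmf_hit[OF mu W.bijective_walk_axioms])
  qed
  have "countable \<Gamma>"
    using assms(2) subgroup.subset[OF assms(6)] by (rule countable_subset[rotated])
  then have ent_H: "entropy_on ?H (convolution_power ?H (hitting_measure G \<mu> \<Gamma>) k)
      = entropy_pmf (map_pmf word_prod (W.blocks k))" for k
    unfolding walk_H[symmetric]
    by (intro H.entropy_on_convolution_power)
       (use theta in \<open>auto simp: \<theta>_def hitting_measure_eq_pmf[OF assms(2) mu assms(6) W.bijective_walk_axioms]\<close>)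
  have ent_G: "entropy_on G (convolution_power G (pmf \<mu>) n) = entropy_pmf (walk_pmf \<mu> n)" for n
    by (intro entropy_on_convolution_power assms refl)
  have Hmu: "entropy_pmf \<mu> < \<infinity>"
    using assms(5) entropy_on_eq_entropy_pmf[OF assms(2) mu, of "pmf \<mu>"] by simp
  define a where "a n = enn2real (entropy_pmf (walk_pmf \<mu> n))" for n
  have a: "entropy_pmf (walk_pmf \<mu> n) = ennreal (a n)" and a0: "0 \<le> a n" for n
    using entropy_walk_pmf_finite[OF mu Hmu, of n] by (auto simp: a_def)
  have "a (m + n) \<le> a m + a n" for m n
    using entropy_walk_pmf_add_le[OF mu, of m n] a0
    by (simp add: a ennreal_plus[symmetric] del: ennreal_plus)
  \<comment> \<open>Both entropies are defined by \<open>lim\<close>, which is meaningful only for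
    convergent sequences. Fekete's lemma supplies convergence for \<open>\<mu>\<close>, and the
    comparison transfers it to the hitting measure.\<close>
  from fekete[of a, OF this a0] obtain L where L: "0 \<le> L" "(\<lambda>n. a n / real n) \<longlonglongrightarrow> L" by blast
  obtain h where h: "entropy_pmf \<mu> = ennreal h" "0 \<le> h"
    using Hmu by (cases "entropy_pmf \<mu>") auto
  obtain C where C: "0 \<le> C" and dev: "\<And>k. (\<integral>\<^sup>+w. of_nat (length w - ?d * k + (?d * k - length w)) \<partial>W.blocks k)
     \<le> ennreal (C * sqrt (real k))"
    using W.deviation_blocks by blast
  \<comment> \<open>The coupling cost with the mean deviation replaced by its bound; it grows like
    the root of \<open>k\<close> and is therefore sublinear.\<close>
  define c where "c k = 2 * ln 2 + (ln 2 + h) * (C * sqrt (real k))" for k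
  have c0: "0 \<le> c k" for k using h C by (simp add: c_def)
  have c_lim: "(\<lambda>k. c k / real k) \<longlonglongrightarrow> 0" unfolding c_def by real_asymp
  have cost: "ennreal (2 * ln 2) + (ennreal (ln 2) + entropy_pmf \<mu>)
      * (\<integral>\<^sup>+w. of_nat (length w - ?d * k + (?d * k - length w)) \<partial>W.blocks k) \<le> ennreal (c k)" for k
  proof -
    have "ennreal (c k) = ennreal (2 * ln 2) + (ennreal (ln 2) + entropy_pmf \<mu>) * ennreal (C * sqrt (real k))"
      using h C by (simp add: c_def ennreal_mult ennreal_plus)
    then show ?thesis using dev[of k] by (auto intro!: add_left_mono mult_left_mono)
  qed
  have sB: "set w \<subseteq> carrier G" if "w \<in> set_pmf (W.blocks k)" for w k
    using W.set_blocks[OF that] mu by blast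
  have d: "0 < ?d" using W.finite_S W.orig_S by (auto simp: card_gt_0_iff)
  have "(\<lambda>k. entropy_pmf (map_pmf word_prod (W.blocks k)) / of_nat k) \<longlonglongrightarrow> of_nat ?d * ennreal L"
  proof (rule comparison_limit[OF L(2,1) a0 d c0 c_lim])
    fix k
    note coupling = entropy_stopping_coupling[OF mu W.stopping_law_blocks[of k], where n = "?d * k", OF sB]
    show "entropy_pmf (map_pmf word_prod (W.blocks k)) \<le> ennreal (a (?d * k)) + ennreal (c k)"
      unfolding a[symmetric] using coupling(1) cost[of k] by (meson add_left_mono order_trans)
    show "ennreal (a (?d * k)) \<le> entropy_pmf (map_pmf word_prod (W.blocks k)) + ennreal (c k)"
      unfolding a[symmetric] using coupling(2) cost[of k] by (meson add_left_mono order_trans)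
  qed
  then have lim_H: "random_walk_entropy ?H (hitting_measure G \<mu> \<Gamma>) = of_nat ?d * ennreal L"
    unfolding random_walk_entropy_def ent_H by (rule limI)
  \<comment> \<open>With factor 1 and error 0 the comparison merely carries the real limit over to
    [0,\<infinity>].\<close>
  have "(\<lambda>n. entropy_pmf (walk_pmf \<mu> n) / of_nat n) \<longlonglongrightarrow> of_nat 1 * ennreal L"
    by (rule comparison_limit[OF L(2,1) a0, of 1 "\<lambda>_. 0"]) (simp_all add: a)
  then have "random_walk_entropy G (pmf \<mu>) = ennreal L"
    unfolding random_walk_entropy_def ent_G by (intro limI) simp
  then show ?thesis by (simp add: lim_H)
qed

end
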